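(* Let $G$ be a cubic, cyclically four-connected graph with $|V(G)|\ge 8$. Let $F$ be a subgraph of $G$ such that every vertex of $F$ has degree at least $2$ in $F$. Let $C$ be a circuit of $G$ of length $4$, vertex-disjoint from $F$. Let $\mathcal{L}$ be a set of cubic graphs each of which has $F$ as a subgraph. Suppose that every $C$-leap of $G$ $F$-contains a member of $\mathcal{L}$. Let $H$ be a cyclically five-connected cubic graph containing $F$ as a subgraph that does not $F$-contain any member of $\mathcal{L}$. Then $H$ does not $F$-contain $G$.
   Context: All graphs finite and simple. $\delta_G(X)$ is the set of edges with exactly one end in $X$; a cubic graph is cyclically $k$-connected if it has girth $\ge k$ and $|\delta_G(X)|\ge k$ for all $X$ such that both $X$ and $V(G)\setminus X$ contain the vertex set of a circuit. A homeomorphic embedding of $G$ in $H$ is a map $\eta$: injective on vertices; each edge $e=v_1v_2$ maps to a path $\eta(e)$ with ends $\eta(v_1),\eta(v_2)$; for distinct edges $e_1,e_2$ no edge or internal vertex of $\eta(e_1)$ lies in $\eta(e_2)$; $\eta(v)\in V(\eta(e))$ iff $v$ is an end of $e$. If $F$ is a subgraph of both $G$ and $H$, $\eta$ fixes $F$ if $\eta(e)=e$ and $\eta(v)=v$ for all $e\in E(F)$, $v\in V(F)$; and $H$ $F$-contains $G$ if there is a homeomorphic embedding of $G$ in $H$ fixing $F$. For distinct edges $ab,cd$ of $G$, $G+(ab,cd)$ is obtained by deleting $ab,cd$ and adding two new vertices $x,y$ and edges $xa,xb,yc,yd,xy$. A $C$-leap of $G$ is a graph $G+(e,f)$ where $e\in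 E(C)$ and $f\in E(G)\setminus E(F)$ has no end in $V(C)$. *)

theory Defs
  imports Main "HOL-Library.Extended_Nat" "HOL-Library.Infinite_Typeclass"
begin

datatype 'a ugraph = UGraph (verts: "'a set") (edges: "'a set set")

definition simple_graph :: "'a ugraph \<Rightarrow> bool" where
  "simple_graph G \<longleftrightarrow> finite (verts G) \<and> (\<forall>e \<in> edges G. e \<subseteq> verts G \<and> card e = 2)"

definition subgraph :: "'a ugraph \<Rightarrow> 'a ugraph \<Rightarrow> bool" where
  "subgraph F G \<longleftrightarrow> simple_graph F \<and> simple_graph G \<and> verts F \<subseteq> verts G \<and> edges F \<subseteq> edges G"

definition degree :: "'a ugraph \<Rightarrow> 'a \<Rightarrow> nat" where
  "degree G v = card {e \<in> edges G. v \<in> e}"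

definition cubic :: "'a ugraph \<Rightarrow> bool" where
  "cubic G \<longleftrightarrow> simple_graph G \<and> (\<forall>v \<in> verts G. degree G v = 3)"

definition path_edges :: "'a list \<Rightarrow> 'a set set" where
  "path_edges p = {{p ! i, p ! Suc i} | i. Suc i < length p}"

text \<open>Paths and circuits are graphs, not vertex sequences: a path does not
  remember its direction, nor a circuit its starting vertex.\<close>

definition is_path :: "'a ugraph \<Rightarrow> 'a \<Rightarrow> 'a \<Rightarrow> bool" where
  "is_path P u v \<longleftrightarrow>
     (\<exists>p. p \<noteq> [] \<and> distinct p \<and> hd p = u \<and> last p = v \<and> P = UGraph (set p) (path_edges p))"

definition circuit :: "'a ugraph \<Rightarrow> bool" where
  "circuit C \<longleftrightarrow>
     (\<exists>p. 3 \<le> length p \<and> distinct p \<and>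
          C = UGraph (set p) (insert {last p, hd p} (path_edges p)))"

definition circuit_of :: "'a ugraph \<Rightarrow> 'a ugraph \<Rightarrow> bool" where
  "circuit_of C G \<longleftrightarrow> circuit C \<and> subgraph C G"

definition circuit_length :: "'a ugraph \<Rightarrow> nat" where
  "circuit_length C = card (edges C)"

definition girth :: "'a ugraph \<Rightarrow> enat" where
  "girth G = (INF C \<in> {C. circuit_of C G}. enat (circuit_length C))"

definition edge_cut :: "'a ugraph \<Rightarrow> 'a set \<Rightarrow> 'a set set" where
  "edge_cut G X = {e \<in> edges G. card (e \<inter> X) = 1}"

definition cyclically_connected :: "nat \<Rightarrow> 'a ugraph \<Rightarrow> bool" where
  "cyclically_connected k G \<longleftrightarrow>
     enat k \<le> girth G \<and>
     (\<forall>X \<subseteq> verts G.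
        (\<exists>C. circuit_of C G \<and> verts C \<subseteq> X) \<and>
        (\<exists>C. circuit_of C G \<and> verts C \<subseteq> verts G - X)
        \<longrightarrow> k \<le> card (edge_cut G X))"

text \<open>An embedding is a pair of maps, \<open>\<eta>v\<close> on vertices and \<open>\<eta>e\<close> on edges.
  Since \<open>\<eta>e e\<close> is a path whose set of ends is \<open>\<eta>v ` e\<close>, its internal
  vertices are those in \<open>verts (\<eta>e e) - \<eta>v ` e\<close>.\<close>

definition homeo_embedding ::
    "('a \<Rightarrow> 'b) \<Rightarrow> ('a set \<Rightarrow> 'b ugraph) \<Rightarrow> 'a ugraph \<Rightarrow> 'b ugraph \<Rightarrow> bool" where
  "homeo_embedding \<eta>v \<eta>e G H \<longleftrightarrow>
     \<eta>v ` verts G \<subseteq> verts H \<and> inj_on \<eta>v (verts G) \<and>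
     (\<forall>u v. {u, v} \<in> edges G \<longrightarrow>
        subgraph (\<eta>e {u, v}) H \<and> is_path (\<eta>e {u, v}) (\<eta>v u) (\<eta>v v)) \<and>
     (\<forall>e1 \<in> edges G. \<forall>e2 \<in> edges G. e1 \<noteq> e2 \<longrightarrow>
        edges (\<eta>e e1) \<inter> edges (\<eta>e e2) = {} \<and>
        (verts (\<eta>e e1) - \<eta>v ` e1) \<inter> verts (\<eta>e e2) = {}) \<and>
     (\<forall>v \<in> verts G. \<forall>e \<in> edges G. \<eta>v v \<in> verts (\<eta>e e) \<longleftrightarrow> v \<in> e)"

text \<open>For an edge \<open>e\<close>, the equation \<open>\<eta>(e) = e\<close> says that the path \<open>\<eta>(e)\<close> consists
  of the edge \<open>e\<close> and its two ends.\<close>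

definition fixes_subgraph ::
    "('a \<Rightarrow> 'a) \<Rightarrow> ('a set \<Rightarrow> 'a ugraph) \<Rightarrow> 'a ugraph \<Rightarrow> bool" where
  "fixes_subgraph \<eta>v \<eta>e F \<longleftrightarrow>
     (\<forall>e \<in> edges F. \<eta>e e = UGraph e {e}) \<and> (\<forall>v \<in> verts F. \<eta>v v = v)"

text \<open>\<open>F_contains F H G\<close>: the graph \<open>H\<close> \<open>F\<close>-contains \<open>G\<close>. It is only meant for
  \<open>F\<close> a subgraph of both.\<close>

definition F_contains :: "'a ugraph \<Rightarrow> 'a ugraph \<Rightarrow> 'a ugraph \<Rightarrow> bool" where
  "F_contains F H G \<longleftrightarrow>
     (\<exists>\<eta>v \<eta>e. homeo_embedding \<eta>v \<eta>e G H \<and> fixes_subgraph \<eta>v \<eta>e F)"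

text \<open>The graph \<open>G + (e, f)\<close> with explicit new vertices \<open>x\<close> (subdividing \<open>e\<close>) and
  \<open>y\<close> (subdividing \<open>f\<close>).\<close>

definition plus_edge :: "'a ugraph \<Rightarrow> 'a set \<Rightarrow> 'a set \<Rightarrow> 'a \<Rightarrow> 'a \<Rightarrow> 'a ugraph" where
  "plus_edge G e f x y =
     UGraph (verts G \<union> {x, y})
       ((edges G - {e, f}) \<union> {{x, a} | a. a \<in> e} \<union> {{y, c} | c. c \<in> f} \<union> {{x, y}})"

text \<open>All choices of the new vertices are admitted. A vertex type of class \<open>infinite\<close>
  ensures that there is one; over a finite type \<open>G\<close> might have no leaps at all.\<close>

definition is_leap :: "'a ugraph \<Rightarrow> 'a ugraph \<Rightarrow> 'a ugraph \<Rightarrow> 'a ugraph \<Rightarrow> bool" where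
  "is_leap F C G G' \<longleftrightarrow>
     (\<exists>e f x y. e \<in> edges C \<and> f \<in> edges G - edges F \<and> f \<inter> verts C = {} \<and>
        x \<notin> verts G \<and> y \<notin> verts G \<and> x \<noteq> y \<and> G' = plus_edge G e f x y)"

end

theory Submission
  imports Defs
begin

text \<open>
  Let \<open>\<eta>\<close> embed \<open>G\<close> in \<open>H\<close>, fixing \<open>F\<close>. Four paths leave the image of \<open>C\<close>, one for each vertex
  of \<open>C\<close>. If the corresponding residual digraph had no walk from the image of \<open>C\<close> to the image
  of \<open>G - C\<close>, the vertices reachable from the former would span a cut of at most four edges with at
  least four vertices on either side; in a cubic graph both sides then contain a circuit, against
  the cyclic connectivity of \<open>H\<close>. Choose \<open>\<eta>\<close>, among the embeddings that agree off \<open>C\<close>, and the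
  walk as short as possible. The walk starts with an \<open>\<eta>\<close>-path from the image of an edge of \<open>C\<close>. If
  this path ends in the image of an edge with no end in \<open>C\<close>, then \<open>H\<close> \<open>F\<close>-contains a \<open>C\<close>-leap, hence
  a member of \<open>\<L>\<close>. Otherwise it ends in one of the four paths, and \<open>\<eta>\<close> can be rerouted so that
  \<open>C\<close> absorbs this end; then the walk gets shorter.
\<close>

section \<open>Paths and homeomorphic embeddings\<close>

text \<open>Rerouting changes the residual digraph, so the obstacle is to keep the rest of the walk
  usable. Agreement off \<open>C\<close> fixes \<open>F\<close>, which misses \<open>C\<close>, and
  leaves the image of \<open>G - C\<close>, the target of the walk, in place. Each forward arc that
  a rerouting creates starts in the old image of \<open>C\<close>, which a shortest walk never meets
  again after its first vertex. An edge of the image of \<open>G\<close> that leaves the image of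
  \<open>C\<close> is a forward arc, so the walk starts with an edge outside the image of
  \<open>G\<close>. As both graphs are cubic, all edges at branch vertices are used up; hence both
  ends of the \<eta>-path are interior to edge images, as subdividing requires. Images of edges of
  \<open>F\<close> have no interior vertex, so the edge hit by the path is outside \<open>F\<close>,
  as a leap demands. A rerouting is a composition: \<open>G\<close> embeds in some
  \<open>G + (e, f)\<close> in a new way, and that graph embeds in \<open>H\<close> by means of the
  \<eta>-path. The numbers: \<open>C\<close> and, as \<open>|V(G)| >= 8\<close>, also
  \<open>G - C\<close> have four vertices. If \<open>|X| >= 4\<close> and at most four edges leave
  \<open>X\<close>, then at least \<open>(3|X| - 4)/2 >= |X|\<close> edges lie inside
  \<open>X\<close>, which forces a circuit.\<close>

lemma path_edges_simps [simp]:
  "path_edges [] = {}" "path_edges [x] = {}"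
  "path_edges (x # y # r) = insert {x, y} (path_edges (y # r))"
proof -
  show "path_edges (x # y # r) = insert {x, y} (path_edges (y # r))"
  proof (intro equalityI subsetI)
    fix e assume "e \<in> path_edges (x # y # r)"
    then obtain i where "e = {(x#y#r) ! i, (x#y#r) ! Suc i}" "Suc i < length (x#y#r)"
      by (auto simp: path_edges_def)
    then show "e \<in> insert {x, y} (path_edges (y # r))"
      by (cases i) (auto simp: path_edges_def)
  next
    fix e assume "e \<in> insert {x, y} (path_edges (y # r))"
    then consider "e = {x,y}" | i where "e = {(y#r) ! i, (y#r) ! Suc i}" "Suc i < length (y#r)"
      by (auto simp: path_edges_def)
    then show "e \<in> path_edges (x # y # r)"
    proof cases
      case 1 then show ?thesis by (auto simp: path_edges_def intro!: exI[of _ 0])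
    next
      case 2 then show ?thesis unfolding path_edges_def
        by (intro CollectI exI[of _ "Suc i"]) auto
    qed
  qed
qed (auto simp: path_edges_def)

lemma path_edges_append: "path_edges (p @ x # q) = path_edges (p @ [x]) \<union> path_edges (x # q)"
proof (induction p)
  case (Cons a p) then show ?case by (cases p) auto
qed simp

lemma path_edges_rev [simp]: "path_edges (rev p) = path_edges p"
proof (induction p)
  case (Cons a p)
  then show ?case
  proof (cases p)
    case (Cons b r)
    have "path_edges (rev r @ b # [a]) = path_edges (rev r @ [b]) \<union> path_edges (b # [a])"
      by (rule path_edges_append)
    then show ?thesis using Cons \<open>path_edges (rev p) = path_edges p\<close> by auto
  qed simp
qed simp

lemma path_edges_subset: "e \<in> path_edges p \<Longrightarrow> e \<subseteq> set p"
  by (auto simp: path_edges_def)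

lemma path_edges_card: "distinct p \<Longrightarrow> e \<in> path_edges p \<Longrightarrow> card e = 2"
  by (auto simp: path_edges_def nth_eq_iff_index_eq)

lemma finite_path_edges: "finite (path_edges p)"
  by (rule finite_subset[of _ "Pow (set p)"]) (auto dest: path_edges_subset)

lemma path_vertex_in_edge: "2 \<le> length p \<Longrightarrow> v \<in> set p \<Longrightarrow> \<exists>e \<in> path_edges p. v \<in> e"
proof (induction p)
  case (Cons a p)
  then show ?case by (cases p; cases "tl p") auto
qed simp

definition path_graph :: "'a list \<Rightarrow> 'a ugraph" where
  "path_graph p = UGraph (set p) (path_edges p)"

lemma path_graph_sel [simp]: "verts (path_graph p) = set p" "edges (path_graph p) = path_edges p"
  by (auto simp: path_graph_def)

lemma path_graph_rev [simp]: "path_graph (rev p) = path_graph p"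
  by (simp add: path_graph_def)

lemma is_pathI: "p \<noteq> [] \<Longrightarrow> distinct p \<Longrightarrow> hd p = u \<Longrightarrow> last p = v \<Longrightarrow> is_path (path_graph p) u v"
  by (auto simp: is_path_def path_graph_def)

lemma is_pathE:
  assumes "is_path P u v"
  obtains p where "p \<noteq> []" "distinct p" "hd p = u" "last p = v" "P = path_graph p"
  using assms by (auto simp: is_path_def path_graph_def)

lemma is_path_sym: "is_path P u v \<Longrightarrow> is_path P v u"
  by (elim is_pathE) (metis is_pathI path_graph_rev distinct_rev hd_rev last_rev rev_is_Nil_conv)

lemma is_path_ends: "is_path P u v \<Longrightarrow> u \<in> verts P \<and> v \<in> verts P"
  by (elim is_pathE) auto

definition graph_union :: "'a ugraph \<Rightarrow> 'a ugraph \<Rightarrow> 'a ugraph" where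
  "graph_union P Q = UGraph (verts P \<union> verts Q) (edges P \<union> edges Q)"

lemma graph_union_sel [simp]:
  "verts (graph_union P Q) = verts P \<union> verts Q" "edges (graph_union P Q) = edges P \<union> edges Q"
  by (auto simp: graph_union_def)

lemma path_graph_append:
  "graph_union (path_graph (p @ [x])) (path_graph (x # q)) = path_graph (p @ x # q)"
  by (subst (3) path_graph_def) (auto simp: graph_union_def path_edges_append[of p x q])

lemma is_path_union:
  assumes "is_path P u v" "is_path Q v w" "verts P \<inter> verts Q \<subseteq> {v}"
  shows "is_path (graph_union P Q) u w"
proof -
  obtain p where p: "p \<noteq> []" "distinct p" "hd p = u" "last p = v" "P = path_graph p"
    using assms(1) by (rule is_pathE)
  obtain q where q: "q \<noteq> []" "distinct q" "hd q = v" "last q = w" "Q = path_graph q"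
    using assms(2) by (rule is_pathE)
  obtain p' where p': "p = p' @ [v]" using p by (metis append_butlast_last_id)
  obtain q' where q': "q = v # q'" using q by (cases q) auto
  have "graph_union P Q = path_graph (p' @ v # q')"
    by (simp add: p q p' q' path_graph_append)
  moreover have "distinct (p' @ v # q')" using p q p' q' assms(3) by auto
  ultimately show ?thesis using p q p' q'
    by (auto intro!: is_pathI simp: hd_append split: if_splits)
qed

text \<open>Recovers the direction that a path graph forgets: the first edge is the only one at the
  start, so the list is forced vertex by vertex. This later identifies the image of an outer edge
  with an explicit list.\<close>

lemma path_graph_unique:
  assumes "path_graph p = path_graph q" "distinct p" "distinct q" "p \<noteq> []" "q \<noteq> []" "hd p = hd q"
  shows "p = q"
proof -
  have "set p = set q \<Longrightarrow> path_edges p = path_edges q \<Longrightarrow> distinct p \<Longrightarrow> distinct q \<Longrightarrow> p \<noteq> [] \<Longrightarrow>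
    q \<noteq> [] \<Longrightarrow> hd p = hd q \<Longrightarrow> p = q"
  proof (induction p arbitrary: q)
    case (Cons a p)
    obtain q' where q: "q = a # q'" using Cons.prems by (cases q) auto
    have set: "set p = set q'" using Cons.prems q by auto
    show ?case
    proof (cases p)
      case Nil then show ?thesis using set q by simp
    next
      case p: (Cons b r)
      obtain c r' where q': "q' = c # r'" using set p by (cases q') auto
      \<comment> \<open>\<open>a\<close> is not repeated, so in each list the first edge is the only
        edge at \<open>a\<close>.\<close>
      have n: "a \<notin> e" if "e \<in> path_edges p \<union> path_edges q'" for e
        using that path_edges_subset[of e p] path_edges_subset[of e q'] Cons.prems q set by auto
      have e: "insert {a,b} (path_edges p) = insert {a,c} (path_edges q')"
        using Cons.prems(2) unfolding q q' p by simp
      have "{a,b} \<in> insert {a,c} (path_edges q')" unfolding e[symmetric] by simp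
      then have "{a,b} = {a,c}" using n[of "{a,b}"] by auto
      moreover have "path_edges p = path_edges q'"
        using e n by (metis (no_types, lifting) UnCI calculation insertI1 insert_ident)
      moreover have "b = c" using calculation by (metis doubleton_eq_iff)
      ultimately show ?thesis using Cons.IH[of q'] set Cons.prems q q' p by auto
    qed
  qed simp
  then show ?thesis using assms by (metis path_graph_sel)
qed

lemma edge_doubleton:
  assumes "simple_graph G" "e \<in> edges G"
  obtains a b where "e = {a, b}" "a \<noteq> b" "a \<in> verts G" "b \<in> verts G"
  using assms by (auto simp: simple_graph_def card_2_iff)

lemma edge_subset: "simple_graph G \<Longrightarrow> e \<in> edges G \<Longrightarrow> e \<subseteq> verts G"
  by (auto simp: simple_graph_def)

lemma edge_card: "simple_graph G \<Longrightarrow> e \<in> edges G \<Longrightarrow> card e = 2"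
  by (auto simp: simple_graph_def)

lemma simple_path_graph: "distinct p \<Longrightarrow> simple_graph (path_graph p)"
  by (auto simp: simple_graph_def dest: path_edges_subset path_edges_card)

lemma subgraph_path_graph:
  "simple_graph H \<Longrightarrow> distinct p \<Longrightarrow> set p \<subseteq> verts H \<Longrightarrow> path_edges p \<subseteq> edges H \<Longrightarrow> subgraph (path_graph p) H"
  by (auto simp: subgraph_def simple_path_graph)

text \<open>One condition on vertices gives both disjointness clauses: a common edge of two images
  would have two ends, each the image of a vertex of \<open>e1 \<inter> e2\<close>, but distinct
  edges of a simple graph share at most one vertex.\<close>

lemma homeo_embeddingI:
  assumes G: "simple_graph G"
    and "\<eta>v ` verts G \<subseteq> verts H" and inj: "inj_on \<eta>v (verts G)"
    and path: "\<And>u v. {u, v} \<in> edges G \<Longrightarrow> subgraph (\<eta>e {u, v}) H \<and> is_path (\<eta>e {u, v}) (\<eta>v u) (\<eta>v v)"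
    and disj: "\<And>e1 e2. e1 \<in> edges G \<Longrightarrow> e2 \<in> edges G \<Longrightarrow> e1 \<noteq> e2 \<Longrightarrow>
      verts (\<eta>e e1) \<inter> verts (\<eta>e e2) \<subseteq> \<eta>v ` (e1 \<inter> e2)"
    and inc: "\<And>v e. v \<in> verts G \<Longrightarrow> e \<in> edges G \<Longrightarrow> \<eta>v v \<in> verts (\<eta>e e) \<Longrightarrow> v \<in> e"
  shows "homeo_embedding \<eta>v \<eta>e G H"
proof -
  have "edges (\<eta>e e1) \<inter> edges (\<eta>e e2) = {}" if e: "e1 \<in> edges G" "e2 \<in> edges G" "e1 \<noteq> e2" for e1 e2
  proof (rule ccontr)
    assume "\<not> ?thesis"
    then obtain g where g: "g \<in> edges (\<eta>e e1)" "g \<in> edges (\<eta>e e2)" by auto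
    have s: "simple_graph (\<eta>e e)" if "e \<in> edges G" for e
      using edge_doubleton[OF G that] path that by (metis subgraph_def)
    have "g \<subseteq> verts (\<eta>e e1) \<inter> verts (\<eta>e e2)" "card g = 2"
      using s e g by (auto dest: edge_subset edge_card)
    then have "g \<subseteq> \<eta>v ` (e1 \<inter> e2)" using disj[OF e] by auto
    moreover have fin: "finite e1" "finite e2"
      using edge_card[OF G e(1)] edge_card[OF G e(2)] by (auto intro: card_ge_0_finite)
    ultimately have "2 \<le> card (e1 \<inter> e2)"
      using \<open>card g = 2\<close> card_mono[of "\<eta>v ` (e1 \<inter> e2)" g] card_image_le[of "e1 \<inter> e2" \<eta>v] by simp
    then have "e1 \<inter> e2 = e1" "e1 \<inter> e2 = e2"
      using fin edge_card[OF G e(1)] edge_card[OF G e(2)] by (intro card_seteq; simp)+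
    then show False using e by simp
  qed
  moreover have "\<eta>v v \<in> verts (\<eta>e e)" if ve: "v \<in> e" "e \<in> edges G" for v e
  proof -
    obtain a b where "e = {a, b}" using edge_doubleton[OF G ve(2)] by metis
    then show ?thesis using path[of a b] ve is_path_ends[of "\<eta>e {a, b}"] by auto
  qed
  moreover have "(verts (\<eta>e e1) - \<eta>v ` e1) \<inter> verts (\<eta>e e2) = {}"
    if "e1 \<in> edges G" "e2 \<in> edges G" "e1 \<noteq> e2" for e1 e2
    using disj[OF that] by auto
  ultimately show ?thesis unfolding homeo_embedding_def using assms(2,3) path inc by metis
qed

lemma
  assumes "homeo_embedding \<eta>v \<eta>e G H"
  shows homeo_embedding_verts: "\<eta>v ` verts G \<subseteq> verts H"
    and homeo_embedding_inj: "inj_on \<eta>v (verts G)"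
    and homeo_embedding_path: "\<And>u v. {u, v} \<in> edges G \<Longrightarrow> is_path (\<eta>e {u, v}) (\<eta>v u) (\<eta>v v)"
    and homeo_embedding_incident: "\<And>v e. v \<in> verts G \<Longrightarrow> e \<in> edges G \<Longrightarrow> \<eta>v v \<in> verts (\<eta>e e) \<longleftrightarrow> v \<in> e"
    and homeo_embedding_edge_disjoint: "\<And>e1 e2. e1 \<in> edges G \<Longrightarrow> e2 \<in> edges G \<Longrightarrow> e1 \<noteq> e2 \<Longrightarrow>
      edges (\<eta>e e1) \<inter> edges (\<eta>e e2) = {}"
  using assms unfolding homeo_embedding_def by simp_all

lemma homeo_embedding_subgraph:
  assumes "homeo_embedding \<eta>v \<eta>e G H" "simple_graph G" "e \<in> edges G"
  shows "subgraph (\<eta>e e) H"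
proof -
  obtain a b where "e = {a, b}" using edge_doubleton[OF assms(2,3)] by metis
  then show ?thesis using assms(1,3) by (simp add: homeo_embedding_def)
qed

lemma homeo_embedding_disjoint:
  assumes "homeo_embedding \<eta>v \<eta>e G H" "simple_graph G" "e1 \<in> edges G" "e2 \<in> edges G" "e1 \<noteq> e2"
  shows "verts (\<eta>e e1) \<inter> verts (\<eta>e e2) \<subseteq> \<eta>v ` (e1 \<inter> e2)"
proof
  fix z assume z: "z \<in> verts (\<eta>e e1) \<inter> verts (\<eta>e e2)"
  have "(verts (\<eta>e e1) - \<eta>v ` e1) \<inter> verts (\<eta>e e2) = {}"
    using assms unfolding homeo_embedding_def by simp
  then obtain w where w: "w \<in> e1" "z = \<eta>v w" using z by auto
  then have "w \<in> e2" using z assms homeo_embedding_incident[OF assms(1), of w e2] edge_subset by blast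
  then show "z \<in> \<eta>v ` (e1 \<inter> e2)" using w by auto
qed

section \<open>Images of paths, and composition of embeddings\<close>

definition lift_edges :: "('a set \<Rightarrow> 'b ugraph) \<Rightarrow> 'a set set \<Rightarrow> 'b ugraph" where
  "lift_edges \<eta>e S = UGraph (\<Union>g\<in>S. verts (\<eta>e g)) (\<Union>g\<in>S. edges (\<eta>e g))"

lemma lift_edges_sel [simp]:
  "verts (lift_edges \<eta>e S) = (\<Union>g\<in>S. verts (\<eta>e g))" "edges (lift_edges \<eta>e S) = (\<Union>g\<in>S. edges (\<eta>e g))"
  by (auto simp: lift_edges_def)

lemma lift_edges_singleton [simp]: "lift_edges \<eta>e {g} = \<eta>e g"
  by (cases "\<eta>e g") (simp add: lift_edges_def)

lemma lift_edges_insert: "lift_edges \<eta>e (insert g S) = graph_union (\<eta>e g) (lift_edges \<eta>e S)"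
  by (simp add: lift_edges_def graph_union_def)

text \<open>Images of consecutive edges meet only in the branch vertex between them and other images
  are disjoint, so they concatenate. The path needs an edge: for a single vertex the lifted graph is
  empty and hence no path.\<close>

lemma lift_path_is_path:
  assumes \<eta>: "homeo_embedding \<eta>v \<eta>e G H" and G: "simple_graph G"
  shows "distinct p \<Longrightarrow> 2 \<le> length p \<Longrightarrow> path_edges p \<subseteq> edges G \<Longrightarrow>
    is_path (lift_edges \<eta>e (path_edges p)) (\<eta>v (hd p)) (\<eta>v (last p))"
proof (induction p)
  case (Cons x p)
  then obtain y r where p: "p = y # r" by (cases p) auto
  show ?case
  proof (cases r)
    case Nil
    then show ?thesis using Cons.prems p homeo_embedding_path[OF \<eta>] by auto
  next
    case r: (Cons z r')
    have xy: "{x, y} \<in> edges G" using Cons.prems p by auto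
    have "verts (\<eta>e {x, y}) \<inter> verts (lift_edges \<eta>e (path_edges p)) \<subseteq> {\<eta>v y}"
    proof
      fix t assume "t \<in> verts (\<eta>e {x, y}) \<inter> verts (lift_edges \<eta>e (path_edges p))"
      then obtain g where g: "g \<in> path_edges p" "t \<in> verts (\<eta>e g)" "t \<in> verts (\<eta>e {x, y})" by auto
      have "x \<notin> g" using path_edges_subset[OF g(1)] Cons.prems by auto
      then have "t \<in> \<eta>v ` ({x,y} \<inter> g)"
        using homeo_embedding_disjoint[OF \<eta> G xy, of g] g Cons.prems p r by auto
      then show "t \<in> {\<eta>v y}" using \<open>x \<notin> g\<close> by auto
    qed
    then have "is_path (graph_union (\<eta>e {x, y}) (lift_edges \<eta>e (path_edges p))) (\<eta>v x) (\<eta>v (last p))"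
      using Cons r p homeo_embedding_path[OF \<eta> xy] by (intro is_path_union) auto
    then show ?thesis using p by (simp add: lift_edges_insert)
  qed
qed simp

text \<open>The paths in \<open>G\<close> are edge-disjoint, so a vertex common to two lifted paths
  lies in the images of two different edges of \<open>G\<close>. It is therefore the image of a
  vertex common to the two paths in \<open>G\<close>, and disjointness there finishes the
  argument.\<close>

lemma homeo_embedding_comp:
  assumes a: "homeo_embedding \<alpha>v \<alpha>e K G" and b: "homeo_embedding \<eta>v \<eta>e G H"
    and K: "simple_graph K" and G: "simple_graph G" and H: "simple_graph H"
  shows "homeo_embedding (\<eta>v \<circ> \<alpha>v) (\<lambda>e. lift_edges \<eta>e (edges (\<alpha>e e))) K H"
proof (rule homeo_embeddingI[OF K])
  show "(\<eta>v \<circ> \<alpha>v) ` verts K \<subseteq> verts H"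
    using homeo_embedding_verts[OF a] homeo_embedding_verts[OF b] by fastforce
  show "inj_on (\<eta>v \<circ> \<alpha>v) (verts K)"
    using homeo_embedding_inj[OF a] homeo_embedding_inj[OF b] homeo_embedding_verts[OF a]
    by (meson comp_inj_on inj_on_subset)
  have sub: "edges (\<alpha>e e) \<subseteq> edges G" "verts (\<alpha>e e) \<subseteq> verts G" if "e \<in> edges K" for e
    using homeo_embedding_subgraph[OF a K that] by (auto simp: subgraph_def)
  fix u v assume uv: "{u, v} \<in> edges K"
  obtain p where p: "p \<noteq> []" "distinct p" "hd p = \<alpha>v u" "last p = \<alpha>v v" "\<alpha>e {u,v} = path_graph p"
    using homeo_embedding_path[OF a uv] by (rule is_pathE)
  have "u \<noteq> v" using edge_card[OF K uv] by auto
  then have "\<alpha>v u \<noteq> \<alpha>v v" using inj_onD[OF homeo_embedding_inj[OF a], of u v] edge_subset[OF K uv] by auto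
  then have "2 \<le> length p" using p by (cases p; cases "tl p") auto
  then have pp: "is_path (lift_edges \<eta>e (edges (\<alpha>e {u, v}))) ((\<eta>v \<circ> \<alpha>v) u) ((\<eta>v \<circ> \<alpha>v) v)"
    using lift_path_is_path[OF b G, of p] p sub(1)[OF uv] by auto
  moreover have "subgraph (lift_edges \<eta>e (edges (\<alpha>e {u, v}))) H"
  proof -
    have "simple_graph (lift_edges \<eta>e (edges (\<alpha>e {u, v})))"
      using pp by (elim is_pathE) (simp add: simple_path_graph)
    moreover have "subgraph (\<eta>e g) H" if "g \<in> edges (\<alpha>e {u, v})" for g
      using homeo_embedding_subgraph[OF b G] sub(1)[OF uv] that by auto
    ultimately show ?thesis using H by (force simp: subgraph_def)
  qed
  ultimately show "subgraph (lift_edges \<eta>e (edges (\<alpha>e {u, v}))) H \<and>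
      is_path (lift_edges \<eta>e (edges (\<alpha>e {u, v}))) ((\<eta>v \<circ> \<alpha>v) u) ((\<eta>v \<circ> \<alpha>v) v)" by blast
next
  have sub: "edges (\<alpha>e e) \<subseteq> edges G" "verts (\<alpha>e e) \<subseteq> verts G" if "e \<in> edges K" for e
    using homeo_embedding_subgraph[OF a K that] by (auto simp: subgraph_def)
  have vsub: "w \<in> verts (\<alpha>e e)" if "e \<in> edges K" "g \<in> edges (\<alpha>e e)" "w \<in> g" for e g w
    using homeo_embedding_subgraph[OF a K that(1)] that by (auto simp: subgraph_def simple_graph_def)
  {
    fix e1 e2 assume e: "e1 \<in> edges K" "e2 \<in> edges K" "e1 \<noteq> e2"
    show "verts (lift_edges \<eta>e (edges (\<alpha>e e1))) \<inter> verts (lift_edges \<eta>e (edges (\<alpha>e e2)))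
      \<subseteq> (\<eta>v \<circ> \<alpha>v) ` (e1 \<inter> e2)"
    proof
      fix z assume "z \<in> verts (lift_edges \<eta>e (edges (\<alpha>e e1))) \<inter> verts (lift_edges \<eta>e (edges (\<alpha>e e2)))"
      then obtain g1 g2 where g: "g1 \<in> edges (\<alpha>e e1)" "z \<in> verts (\<eta>e g1)"
        "g2 \<in> edges (\<alpha>e e2)" "z \<in> verts (\<eta>e g2)" by auto
      have "g1 \<noteq> g2" using homeo_embedding_edge_disjoint[OF a e] g by auto
      then obtain w where w: "z = \<eta>v w" "w \<in> g1" "w \<in> g2"
        using homeo_embedding_disjoint[OF b G, of g1 g2] g sub e by blast
      then have "w \<in> verts (\<alpha>e e1) \<inter> verts (\<alpha>e e2)" using vsub e g by blast
      then show "z \<in> (\<eta>v \<circ> \<alpha>v) ` (e1 \<inter> e2)"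
        using homeo_embedding_disjoint[OF a K e] w by auto
    qed
  }
  fix v e assume v: "v \<in> verts K" "e \<in> edges K" "(\<eta>v \<circ> \<alpha>v) v \<in> verts (lift_edges \<eta>e (edges (\<alpha>e e)))"
  then obtain g where g: "g \<in> edges (\<alpha>e e)" "\<eta>v (\<alpha>v v) \<in> verts (\<eta>e g)" by auto
  then have "\<alpha>v v \<in> g"
    using homeo_embedding_incident[OF b, of "\<alpha>v v" g] sub[OF v(2)] homeo_embedding_verts[OF a] v by auto
  then show "v \<in> e" using vsub[OF v(2) g(1)] homeo_embedding_incident[OF a v(1,2)] by auto
qed

lemma F_contains_trans:
  assumes "F_contains F H G" "F_contains F G K" "simple_graph K" "simple_graph G" "simple_graph H"
  shows "F_contains F H K"
proof -
  obtain \<eta>v \<eta>e \<alpha>v \<alpha>e where "homeo_embedding \<eta>v \<eta>e G H" "fixes_subgraph \<eta>v \<eta>e F"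
    "homeo_embedding \<alpha>v \<alpha>e K G" "fixes_subgraph \<alpha>v \<alpha>e F"
    using assms(1,2) by (auto simp: F_contains_def)
  then have "homeo_embedding (\<eta>v \<circ> \<alpha>v) (\<lambda>e. lift_edges \<eta>e (edges (\<alpha>e e))) K H"
    "fixes_subgraph (\<eta>v \<circ> \<alpha>v) (\<lambda>e. lift_edges \<eta>e (edges (\<alpha>e e))) F"
    using homeo_embedding_comp assms(3-5) by (blast, simp add: fixes_subgraph_def)
  then show ?thesis unfolding F_contains_def by blast
qed

section \<open>Adding an edge\<close>

text \<open>Being a path is symmetric in the ends, so one ordering of the ends per edge suffices.
  This suits edge maps that are given by cases on named edges such as \<open>{x, a}\<close>.\<close>

lemma homeo_embeddingI_edges:
  assumes "simple_graph G" "\<eta>v ` verts G \<subseteq> verts H" "inj_on \<eta>v (verts G)"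
    and path: "\<And>e. e \<in> edges G \<Longrightarrow> \<exists>u v. e = {u, v} \<and> subgraph (\<eta>e e) H \<and> is_path (\<eta>e e) (\<eta>v u) (\<eta>v v)"
    and "\<And>e1 e2. e1 \<in> edges G \<Longrightarrow> e2 \<in> edges G \<Longrightarrow> e1 \<noteq> e2 \<Longrightarrow>
      verts (\<eta>e e1) \<inter> verts (\<eta>e e2) \<subseteq> \<eta>v ` (e1 \<inter> e2)"
    and "\<And>v e. v \<in> verts G \<Longrightarrow> e \<in> edges G \<Longrightarrow> \<eta>v v \<in> verts (\<eta>e e) \<Longrightarrow> v \<in> e"
  shows "homeo_embedding \<eta>v \<eta>e G H"
proof (rule homeo_embeddingI)
  fix u v assume "{u, v} \<in> edges G"
  with path obtain u' v' where "{u, v} = {u', v'}" "subgraph (\<eta>e {u, v}) H"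
    "is_path (\<eta>e {u, v}) (\<eta>v u') (\<eta>v v')" by blast
  then show "subgraph (\<eta>e {u, v}) H \<and> is_path (\<eta>e {u, v}) (\<eta>v u) (\<eta>v v)"
    by (metis doubleton_eq_iff is_path_sym)
qed (use assms in auto)

definition subdivide :: "'a ugraph \<Rightarrow> 'a \<Rightarrow> 'a \<Rightarrow> 'a \<Rightarrow> 'a ugraph" where
  "subdivide G a b x = UGraph (insert x (verts G)) ((edges G - {{a, b}}) \<union> {{x, a}, {x, b}})"

lemma subdivide_sel [simp]:
  "verts (subdivide G a b x) = insert x (verts G)"
  "edges (subdivide G a b x) = (edges G - {{a, b}}) \<union> {{x, a}, {x, b}}"
  by (auto simp: subdivide_def)

lemma simple_subdivide:
  assumes "simple_graph G" "{a, b} \<in> edges G" "x \<notin> verts G"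
  shows "simple_graph (subdivide G a b x)"
  using assms edge_subset[OF assms(1,2)] by (auto simp: simple_graph_def card_insert_if)

text \<open>\<open>\<eta>e {a, b}\<close> is cut at \<open>s\<close> into the images of the two new
  edges. Nonempty \<open>p\<close> and \<open>q\<close> make \<open>s\<close> an interior vertex of
  the path, so \<open>s\<close> is not yet the image of a vertex and can become that of
  \<open>x\<close>.\<close>

lemma subdivide_embedding:
  assumes \<eta>: "homeo_embedding \<eta>v \<eta>e G H" and G: "simple_graph G"
    and ab: "{a, b} \<in> edges G" and x: "x \<notin> verts G"
    and P: "\<eta>e {a, b} = path_graph (p @ s # q)" "distinct (p @ s # q)" "p \<noteq> []" "q \<noteq> []"
      "hd p = \<eta>v a" "last q = \<eta>v b"
  shows "homeo_embedding (\<eta>v(x := s)) (\<eta>e({x, a} := path_graph (p @ [s]), {x, b} := path_graph (s # q)))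
    (subdivide G a b x) H"
    (is "homeo_embedding ?v ?e ?G H")
proof -
  have abG: "a \<in> verts G" "b \<in> verts G" "a \<noteq> b" "a \<noteq> x" "b \<noteq> x"
    using edge_subset[OF G ab] edge_card[OF G ab] x by auto
  have xg: "x \<notin> g" if "g \<in> edges G" for g using edge_subset[OF G that] x by auto
  have eG: "?e g = \<eta>e g" if "g \<in> edges G" for g using xg[OF that] by auto
  have ea: "?e {x, a} = path_graph (p @ [s])" and eb: "?e {x, b} = path_graph (s # q)"
    using abG by (auto simp: doubleton_eq_iff)
  have H: "subgraph (path_graph (p @ s # q)) H"
    using homeo_embedding_subgraph[OF \<eta> G ab] P by simp
  have mem: "\<eta>v a \<in> set p" "\<eta>v b \<in> set q" using P by (metis list.set_sel(1), metis last_in_set)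
  have sv: "\<eta>v v \<noteq> s" if "v \<in> verts G" for v
  proof
    assume "\<eta>v v = s"
    then have "v \<in> {a, b}" using homeo_embedding_incident[OF \<eta> that ab] P by simp
    then show False using \<open>\<eta>v v = s\<close> mem P by auto
  qed
  have old: "\<exists>w. z = \<eta>v w \<and> w \<in> g \<and> w \<in> {a, b}"
    if "g \<in> edges G" "g \<noteq> {a, b}" "z \<in> verts (\<eta>e g)" "z \<in> set (p @ s # q)" for g z
    using homeo_embedding_disjoint[OF \<eta> G that(1) ab that(2)] that P by auto
  have dA: "verts (\<eta>e g) \<inter> set (p @ [s]) \<subseteq> ?v ` (g \<inter> {x, a})"
    if g: "g \<in> edges G" "g \<noteq> {a, b}" for g
  proof
    fix z assume z: "z \<in> verts (\<eta>e g) \<inter> set (p @ [s])"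
    then obtain w where w: "z = \<eta>v w" "w \<in> g" "w \<in> {a, b}" using old[OF g, of z] by auto
    have "w = a" using w z mem P sv abG by auto
    then show "z \<in> ?v ` (g \<inter> {x, a})" using w abG by auto
  qed
  have dB: "verts (\<eta>e g) \<inter> set (s # q) \<subseteq> ?v ` (g \<inter> {x, b})"
    if g: "g \<in> edges G" "g \<noteq> {a, b}" for g
  proof
    fix z assume z: "z \<in> verts (\<eta>e g) \<inter> set (s # q)"
    then obtain w where w: "z = \<eta>v w" "w \<in> g" "w \<in> {a, b}" using old[OF g, of z] by auto
    have "w = b" using w z mem P sv abG by auto
    then show "z \<in> ?v ` (g \<inter> {x, b})" using w abG by auto
  qed
  have dAB: "set (p @ [s]) \<inter> set (s # q) \<subseteq> ?v ` ({x, a} \<inter> {x, b})" using P by auto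
  show ?thesis
  proof (rule homeo_embeddingI_edges)
    show "simple_graph ?G" by (rule simple_subdivide[OF G ab x])
    show "?v ` verts ?G \<subseteq> verts H"
      using homeo_embedding_verts[OF \<eta>] H by (auto simp: subgraph_def)
    show "inj_on ?v (verts ?G)"
      using homeo_embedding_inj[OF \<eta>] sv x by (auto simp: inj_on_def)
  next
    fix e assume "e \<in> edges ?G"
    then consider "e \<in> edges G" | "e = {x, a}" | "e = {x, b}" by auto
    then show "\<exists>u v. e = {u, v} \<and> subgraph (?e e) H \<and> is_path (?e e) (?v u) (?v v)"
    proof cases
      case 1
      obtain u v where uv: "e = {u, v}" "u \<in> verts G" "v \<in> verts G" using edge_doubleton[OF G 1] by metis
      then have "is_path (?e e) (?v u) (?v v)"
        using homeo_embedding_path[OF \<eta>, of u v] eG[OF 1] 1 x by auto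
      then show ?thesis using homeo_embedding_subgraph[OF \<eta> G 1] unfolding eG[OF 1] using uv by blast
    next
      case 2
      have pa: "is_path (path_graph (p @ [s])) (?v a) (?v x)" using P abG by (intro is_pathI) auto
      have sa: "subgraph (path_graph (p @ [s])) H"
        using H P by (auto simp: subgraph_def simple_path_graph path_edges_append[of p s q])
      show ?thesis unfolding 2 ea
        by (intro exI[of _ a] exI[of _ x] conjI) (rule insert_commute pa sa)+
    next
      case 3
      have pb: "is_path (path_graph (s # q)) (?v x) (?v b)" using P abG by (intro is_pathI) auto
      have sb: "subgraph (path_graph (s # q)) H"
        using H P by (auto simp: subgraph_def simple_path_graph path_edges_append[of p s q])
      show ?thesis unfolding 3 eb
        by (intro exI[of _ x] exI[of _ b] conjI) (rule refl pb sb)+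
    qed
  next
    fix e1 e2 assume e: "e1 \<in> edges ?G" "e2 \<in> edges ?G" "e1 \<noteq> e2"
    consider "e1 \<in> edges G" "e1 \<noteq> {a, b}" | "e1 = {x, a}" | "e1 = {x, b}" using e(1) by auto
    note c1 = this
    consider "e2 \<in> edges G" "e2 \<noteq> {a, b}" | "e2 = {x, a}" | "e2 = {x, b}" using e(2) by auto
    then show "verts (?e e1) \<inter> verts (?e e2) \<subseteq> ?v ` (e1 \<inter> e2)"
    proof cases
      case 1
      show ?thesis
      proof (cases rule: c1)
        case g: 1
        have "verts (\<eta>e e1) \<inter> verts (\<eta>e e2) \<subseteq> \<eta>v ` (e1 \<inter> e2)"
          using homeo_embedding_disjoint[OF \<eta> G g(1) 1(1) e(3)] .
        moreover have "\<eta>v ` (e1 \<inter> e2) = ?v ` (e1 \<inter> e2)" using xg[OF 1(1)] by auto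
        ultimately show ?thesis using eG g 1 by simp
      next
        case 2 then show ?thesis unfolding 2 ea eG[OF 1(1)] using dA[OF 1] by (simp add: Int_commute)
      next
        case 3 then show ?thesis unfolding 3 eb eG[OF 1(1)] using dB[OF 1] by (simp add: Int_commute)
      qed
    next
      case 2
      show ?thesis
      proof (cases rule: c1)
        case g: 1 show ?thesis unfolding 2 ea eG[OF g(1)] using dA[OF g] by simp
      next
        case g: 3 show ?thesis unfolding 2 g ea eb path_graph_sel
          using dAB by (metis Int_commute)
      qed (use 2 e in auto)
    next
      case 3
      show ?thesis
      proof (cases rule: c1)
        case g: 1 show ?thesis unfolding 3 eb eG[OF g(1)] using dB[OF g] by simp
      next
        case g: 2 show ?thesis unfolding 3 g ea eb path_graph_sel by (rule dAB)
      qed (use 3 e in auto)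
    qed
  next
    fix v e assume v: "v \<in> verts ?G" "e \<in> edges ?G" "?v v \<in> verts (?e e)"
    consider "e \<in> edges G" "e \<noteq> {a, b}" | "e = {x, a}" | "e = {x, b}" using v(2) by auto
    then show "v \<in> e"
    proof cases
      case 1
      show ?thesis
      proof (cases "v = x")
        case True
        then have "s \<in> verts (\<eta>e e)" using v eG[OF 1(1)] by simp
        then show ?thesis using old[OF 1, of s] sv abG by auto
      next
        case False
        then show ?thesis using v eG[OF 1(1)] homeo_embedding_incident[OF \<eta>, of v e] 1 by simp
      qed
    next
      case 2
      show ?thesis
      proof (cases "v = x")
        case False
        then have "\<eta>v v \<in> set (p @ [s])" "v \<in> verts G" using v ea 2 by auto
        moreover from this have "v \<in> {a, b}" using homeo_embedding_incident[OF \<eta> _ ab, of v] P by auto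
        ultimately show ?thesis using 2 mem P sv by auto
      qed (use 2 in auto)
    next
      case 3
      show ?thesis
      proof (cases "v = x")
        case False
        then have "\<eta>v v \<in> set (s # q)" "v \<in> verts G" using v eb 3 by auto
        moreover from this have "v \<in> {a, b}" using homeo_embedding_incident[OF \<eta> _ ab, of v] P by auto
        ultimately show ?thesis using 3 mem P sv by auto
      qed (use 3 in auto)
    qed
  qed
qed

definition add_edge :: "'a ugraph \<Rightarrow> 'a \<Rightarrow> 'a \<Rightarrow> 'a ugraph" where
  "add_edge G x y = UGraph (verts G) (insert {x, y} (edges G))"

lemma add_edge_sel [simp]:
  "verts (add_edge G x y) = verts G" "edges (add_edge G x y) = insert {x, y} (edges G)"
  by (auto simp: add_edge_def)

lemma add_edge_embedding:
  assumes \<eta>: "homeo_embedding \<eta>v \<eta>e G H" and G: "simple_graph G" and H: "simple_graph H"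
    and xy: "x \<in> verts G" "y \<in> verts G" "x \<noteq> y" "{x, y} \<notin> edges G"
    and Q: "distinct Q" "Q \<noteq> []" "hd Q = \<eta>v x" "last Q = \<eta>v y" "set Q \<subseteq> verts H" "path_edges Q \<subseteq> edges H"
    and Qv: "\<And>v. v \<in> verts G \<Longrightarrow> \<eta>v v \<in> set Q \<Longrightarrow> v \<in> {x, y}"
    and Qe: "\<And>e. e \<in> edges G \<Longrightarrow> set Q \<inter> verts (\<eta>e e) \<subseteq> {\<eta>v x, \<eta>v y}"
  shows "homeo_embedding \<eta>v (\<eta>e({x, y} := path_graph Q)) (add_edge G x y) H" (is "homeo_embedding \<eta>v ?e ?G H")
proof -
  have eG: "?e g = \<eta>e g" if "g \<in> edges G" for g using that xy by auto
  have d: "set Q \<inter> verts (\<eta>e g) \<subseteq> \<eta>v ` ({x, y} \<inter> g)" if g: "g \<in> edges G" for g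
  proof
    fix z assume z: "z \<in> set Q \<inter> verts (\<eta>e g)"
    then obtain w where "z = \<eta>v w" "w \<in> {x, y}" using Qe[OF g] by auto
    then show "z \<in> \<eta>v ` ({x, y} \<inter> g)"
      using z homeo_embedding_incident[OF \<eta> _ g, of w] xy by auto
  qed
  show ?thesis
  proof (rule homeo_embeddingI_edges)
    show "simple_graph ?G" using G xy by (auto simp: simple_graph_def)
    show "\<eta>v ` verts ?G \<subseteq> verts H" using homeo_embedding_verts[OF \<eta>] by simp
    show "inj_on \<eta>v (verts ?G)" using homeo_embedding_inj[OF \<eta>] by simp
  next
    fix e assume "e \<in> edges ?G"
    then consider "e \<in> edges G" | "e = {x, y}" by auto
    then show "\<exists>u v. e = {u, v} \<and> subgraph (?e e) H \<and> is_path (?e e) (\<eta>v u) (\<eta>v v)"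
    proof cases
      case 1
      obtain u v where uv: "e = {u, v}" using edge_doubleton[OF G 1] by metis
      then have "is_path (?e e) (\<eta>v u) (\<eta>v v)"
        using homeo_embedding_path[OF \<eta>, of u v] eG[OF 1] 1 by auto
      then show ?thesis using homeo_embedding_subgraph[OF \<eta> G 1] unfolding eG[OF 1] using uv by blast
    next
      case 2
      have "is_path (path_graph Q) (\<eta>v x) (\<eta>v y)" using Q by (intro is_pathI)
      then show ?thesis using subgraph_path_graph[OF H Q(1,5,6)] 2 by auto
    qed
  next
    fix e1 e2 assume e: "e1 \<in> edges ?G" "e2 \<in> edges ?G" "e1 \<noteq> e2"
    then consider "e1 \<in> edges G" "e2 \<in> edges G" | "e1 = {x, y}" "e2 \<in> edges G" | "e2 = {x, y}" "e1 \<in> edges G"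
      by auto
    then show "verts (?e e1) \<inter> verts (?e e2) \<subseteq> \<eta>v ` (e1 \<inter> e2)"
    proof cases
      case 1 then show ?thesis using homeo_embedding_disjoint[OF \<eta> G 1 e(3)] eG by simp
    next
      case 2 then show ?thesis using d[OF 2(2)] eG[OF 2(2)] by simp
    next
      case 3 then show ?thesis using d[OF 3(2)] eG[OF 3(2)] by (simp add: Int_commute)
    qed
  next
    fix v e assume "v \<in> verts ?G" "e \<in> edges ?G" "\<eta>v v \<in> verts (?e e)"
    then show "v \<in> e" using homeo_embedding_incident[OF \<eta>, of v e] eG Qv by (cases "e = {x, y}") auto
  qed
qed

text \<open>Breaks \<open>G + (e, f)\<close> into two subdivisions and one added edge, so that an
  embedding can be extended in three separate steps.\<close>

lemma plus_edge_conv: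
  assumes "simple_graph G" "{a, b} \<in> edges G" "{c, d} \<in> edges G" "{a, b} \<noteq> {c, d}"
    "x \<notin> verts G" "y \<notin> verts G" "x \<noteq> y"
  shows "plus_edge G {a, b} {c, d} x y = add_edge (subdivide (subdivide G a b x) c d y) x y"
proof -
  have "x \<notin> {c, d}" using edge_subset[OF assms(1,3)] assms(5) by auto
  then have 1: "{x, a} \<noteq> {c, d}" "{x, b} \<noteq> {c, d}" by auto
  have 2: "{{z, u} |u. u \<in> {v, w}} = {{z, v}, {z, w}}" for z v w :: 'a by blast
  have 3: "E - {r} \<union> {u, v} - {w} = E - {r, w} \<union> {u, v}" if "u \<noteq> w" "v \<noteq> w" for E and r u v w :: "'a set"
    using that by blast
  show ?thesis unfolding plus_edge_def add_edge_def subdivide_def ugraph.sel 2 3[OF 1]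
    by (simp only: Un_insert_right Un_empty_right insert_commute)
qed

lemma simple_plus_edge:
  assumes "simple_graph G" "{a, b} \<in> edges G" "{c, d} \<in> edges G" "{a, b} \<noteq> {c, d}"
    "x \<notin> verts G" "y \<notin> verts G" "x \<noteq> y"
  shows "simple_graph (plus_edge G {a, b} {c, d} x y)"
proof -
  have "simple_graph (subdivide G a b x)" by (rule simple_subdivide) fact+
  then have "simple_graph (subdivide (subdivide G a b x) c d y)"
    using assms by (intro simple_subdivide) auto
  then show ?thesis unfolding plus_edge_conv[OF assms]
    using assms by (auto simp: simple_graph_def)
qed

definition embedded_verts :: "('a \<Rightarrow> 'b) \<Rightarrow> ('a set \<Rightarrow> 'b ugraph) \<Rightarrow> 'a ugraph \<Rightarrow> 'b set" where
  "embedded_verts \<eta>v \<eta>e G = \<eta>v ` verts G \<union> (\<Union>e\<in>edges G. verts (\<eta>e e))"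

text \<open>\<open>Q\<close> is an \<eta>-path: its interior avoids the image of \<open>G\<close>,
  so it can serve as the image of the new edge \<open>xy\<close>. The lemma has two uses: for leaps,
  and for reroutings, where \<open>cd\<close> has an end in \<open>C\<close> and the larger graph is
  only an intermediate stage.\<close>

lemma plus_edge_embedding:
  assumes \<eta>: "homeo_embedding \<eta>v \<eta>e G H" and G: "simple_graph G" and H: "simple_graph H"
    and ab: "{a, b} \<in> edges G" and cd: "{c, d} \<in> edges G" and ne: "{a, b} \<noteq> {c, d}"
    and xy: "x \<notin> verts G" "y \<notin> verts G" "x \<noteq> y"
    and P: "\<eta>e {a, b} = path_graph (p @ s # q)" "distinct (p @ s # q)" "p \<noteq> []" "q \<noteq> []"
      "hd p = \<eta>v a" "last q = \<eta>v b"
    and P': "\<eta>e {c, d} = path_graph (p' @ t # q')" "distinct (p' @ t # q')" "p' \<noteq> []" "q' \<noteq> []"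
      "hd p' = \<eta>v c" "last q' = \<eta>v d"
    and Q: "distinct Q" "Q \<noteq> []" "hd Q = s" "last Q = t" "set Q \<subseteq> verts H" "path_edges Q \<subseteq> edges H"
      "set Q \<inter> embedded_verts \<eta>v \<eta>e G \<subseteq> {s, t}"
  shows "homeo_embedding (\<eta>v(x := s, y := t))
    (\<eta>e({x, a} := path_graph (p @ [s]), {x, b} := path_graph (s # q),
        {y, c} := path_graph (p' @ [t]), {y, d} := path_graph (t # q'), {x, y} := path_graph Q))
    (plus_edge G {a, b} {c, d} x y) H"
proof -
  let ?G1 = "subdivide G a b x" let ?G2 = "subdivide ?G1 c d y"
  let ?e1 = "\<eta>e({x, a} := path_graph (p @ [s]), {x, b} := path_graph (s # q))"
  let ?e2 = "?e1({y, c} := path_graph (p' @ [t]), {y, d} := path_graph (t # q'))"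
  have in_verts: "a \<in> verts G" "b \<in> verts G" "c \<in> verts G" "d \<in> verts G"
    using edge_subset[OF G ab] edge_subset[OF G cd] by auto
  have 1: "homeo_embedding (\<eta>v(x := s)) ?e1 ?G1 H"
    by (rule subdivide_embedding[OF \<eta> G ab xy(1) P])
  have G1: "simple_graph ?G1" by (rule simple_subdivide[OF G ab xy(1)])
  have x_cd: "x \<notin> {c, d}" using in_verts xy by auto
  then have "?e1 {c, d} = \<eta>e {c, d}" by auto
  then have 2: "homeo_embedding (\<eta>v(x := s, y := t)) ?e2 ?G2 H"
    using cd ne xy P' x_cd in_verts by (intro subdivide_embedding[OF 1 G1]) auto
  have G2: "simple_graph ?G2" using cd ne xy by (intro simple_subdivide[OF G1]) auto
  have sub: "verts (?e2 e) \<subseteq> embedded_verts \<eta>v \<eta>e G" if e: "e \<in> edges ?G2" for e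
  proof -
    have "set (p @ s # q) \<subseteq> embedded_verts \<eta>v \<eta>e G" "set (p' @ t # q') \<subseteq> embedded_verts \<eta>v \<eta>e G"
      using ab cd P(1) P'(1) unfolding embedded_verts_def by force+
    moreover have "e \<in> edges G \<Longrightarrow> verts (\<eta>e e) \<subseteq> embedded_verts \<eta>v \<eta>e G"
      by (auto simp: embedded_verts_def)
    moreover have "?e2 e = \<eta>e e \<and> e \<in> edges G \<or>
        ?e2 e \<in> path_graph ` {p @ [s], s # q, p' @ [t], t # q'}"
      using e by (simp add: fun_upd_apply) blast
    ultimately show ?thesis by (elim disjE conjE) (auto simp del: fun_upd_apply)
  qed
  have "homeo_embedding (\<eta>v(x := s, y := t)) (?e2({x, y} := path_graph Q)) (add_edge ?G2 x y) H"
  proof (rule add_edge_embedding[OF 2 G2 H])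
    show "{x, y} \<notin> edges ?G2" using xy in_verts edge_subset[OF G, of "{x, y}"] by (auto simp: doubleton_eq_iff)
    show "v \<in> {x, y}" if v: "v \<in> verts ?G2" "(\<eta>v(x := s, y := t)) v \<in> set Q" for v
    proof (rule ccontr)
      assume n: "v \<notin> {x, y}"
      then have "v \<in> verts G" "\<eta>v v \<in> set Q" using v by auto
      then have "\<eta>v v \<in> {s, t}" using Q(7) unfolding embedded_verts_def by blast
      then have "(\<eta>v(x := s, y := t)) v \<in> (\<eta>v(x := s, y := t)) ` {x, y}" using n xy by auto
      moreover have "{x, y} \<subseteq> verts ?G2" by auto
      ultimately show False using n v homeo_embedding_inj[OF 2] by (metis inj_on_image_mem_iff)
    qed
    show "set Q \<inter> verts (?e2 e) \<subseteq> {(\<eta>v(x := s, y := t)) x, (\<eta>v(x := s, y := t)) y}" if "e \<in> edges ?G2" for e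
    proof -
      have "(\<eta>v(x := s, y := t)) x = s" "(\<eta>v(x := s, y := t)) y = t" using xy by auto
      then show ?thesis using sub[OF that] Q(7) by (simp only:) blast
    qed
  qed (use xy Q in \<open>simp_all del: fun_upd_apply add: fun_upd_def\<close>)
  then show ?thesis unfolding plus_edge_conv[OF G ab cd ne xy] .
qed

section \<open>Rerouting\<close>

lemma plus_edge_sel:
  "verts (plus_edge G {a, b} {c, d} x y) = verts G \<union> {x, y}"
  "edges (plus_edge G {a, b} {c, d} x y) = (edges G - {{a, b}, {c, d}}) \<union> {{x, a}, {x, b}, {y, c}, {y, d}, {x, y}}"
proof -
  have 2: "{{z, u} |u. u \<in> {v, w}} = {{z, v}, {z, w}}" for z v w :: 'a by blast
  show "edges (plus_edge G {a, b} {c, d} x y) =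
      (edges G - {{a, b}, {c, d}}) \<union> {{x, a}, {x, b}, {y, c}, {y, d}, {x, y}}"
    unfolding plus_edge_def ugraph.sel 2 by (simp only: Un_insert_right Un_empty_right insert_commute)
qed (simp add: plus_edge_def)

section \<open>New embeddings of a graph in its one-edge extensions\<close>

text \<open>The identity on edges, each seen as a path with one edge. The edge maps of the rerouting
  embeddings are finite updates of it.\<close>

definition edge_graph :: "'a set \<Rightarrow> 'a ugraph" where
  "edge_graph e = UGraph e {e}"

lemma edge_graph_sel [simp]: "verts (edge_graph e) = e" "edges (edge_graph e) = {e}"
  by (auto simp: edge_graph_def)

lemma edge_graph_path: "edge_graph {u, v} = path_graph [u, v]"
  by (auto simp: edge_graph_def path_graph_def)

lemma edge_graph_embedding_step:
  assumes "simple_graph G" "g \<in> edges G" "simple_graph G'" "g \<in> edges G'"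
  shows "\<exists>u v. g = {u, v} \<and> u \<in> verts G \<and> v \<in> verts G \<and> subgraph (edge_graph g) G' \<and> is_path (edge_graph g) u v"
proof -
  obtain u v where uv: "g = {u, v}" "u \<noteq> v" "u \<in> verts G" "v \<in> verts G"
    using edge_doubleton[OF assms(1,2)] by metis
  then have "is_path (edge_graph g) u v" by (auto simp: edge_graph_path intro!: is_pathI)
  moreover have "subgraph (edge_graph g) G'"
    using assms edge_subset[OF assms(3,4)] edge_card[OF assms(3,4)]
    by (auto simp: subgraph_def simple_graph_def intro: finite_subset)
  ultimately show ?thesis using uv by blast
qed

text \<open>Subdivide \<open>va\<close> by \<open>x\<close> and \<open>vd\<close> by \<open>y\<close>, and join \<open>x\<close> to \<open>y\<close>. Deleting the edge \<open>vx\<close> leaves a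
  subdivision of \<open>G\<close> in which \<open>y\<close> plays the role of \<open>v\<close>.\<close>

lemma reroute_adjacent_embedding:
  assumes G: "simple_graph G" and v: "{v, a} \<in> edges G" "{v, b} \<in> edges G" "{v, d} \<in> edges G"
    and dist: "distinct [a, b, d]"
    and nb: "\<And>e. e \<in> edges G \<Longrightarrow> v \<in> e \<Longrightarrow> e \<in> {{v, a}, {v, b}, {v, d}}"
    and xy: "x \<notin> verts G" "y \<notin> verts G" "x \<noteq> y"
  shows "homeo_embedding (id(v := y))
    (edge_graph({v, a} := path_graph [y, x, a], {v, b} := path_graph [y, v, b], {v, d} := path_graph [y, d]))
    G (plus_edge G {v, a} {v, d} x y)" (is "homeo_embedding ?v ?e G ?G")
proof -
  have V: "v \<in> verts G" "a \<in> verts G" "b \<in> verts G" "d \<in> verts G" "v \<noteq> a" "v \<noteq> b" "v \<noteq> d"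
    using v edge_subset[OF G v(1)] edge_subset[OF G v(2)] edge_subset[OF G v(3)]
      edge_card[OF G v(1)] edge_card[OF G v(2)] edge_card[OF G v(3)] by auto
  have neq: "x \<noteq> v" "y \<noteq> v" "x \<noteq> a" "x \<noteq> b" "x \<noteq> d" "y \<noteq> a" "y \<noteq> b" "y \<noteq> d" using V xy by auto
  have ne: "{v, a} \<noteq> {v, d}" "{v, a} \<noteq> {v, b}" "{v, b} \<noteq> {v, d}" using dist by (auto simp: doubleton_eq_iff)
  have G': "simple_graph ?G" by (rule simple_plus_edge[OF G v(1,3) ne(1) xy])
  note vG = plus_edge_sel(1)[of G v a v d x y]
  note eG = plus_edge_sel(2)[of G v a v d x y]
  have ev: "?e {v, a} = path_graph [y, x, a]" "?e {v, b} = path_graph [y, v, b]" "?e {v, d} = path_graph [y, d]"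
    using ne by auto
  have e0: "?e g = edge_graph g" if "v \<notin> g" for g using that by auto
  have xyg: "x \<notin> g" "y \<notin> g" if "g \<in> edges G" for g using edge_subset[OF G that] xy by auto
  have cases: "v \<notin> g \<or> g = {v, a} \<or> g = {v, b} \<or> g = {v, d}" if "g \<in> edges G" for g
    using nb[OF that] by auto
  have p1: "is_path (path_graph [y, x, a]) (?v v) (?v a)" "is_path (path_graph [y, v, b]) (?v v) (?v b)"
    "is_path (path_graph [y, d]) (?v v) (?v d)"
    using V neq xy by (auto intro!: is_pathI)
  have s1: "subgraph (path_graph [y, x, a]) ?G" "subgraph (path_graph [y, v, b]) ?G"
    "subgraph (path_graph [y, d]) ?G"
    using V neq xy v dist by (intro subgraph_path_graph[OF G']; simp add: vG eG doubleton_eq_iff; blast)+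
  show ?thesis
  proof (rule homeo_embeddingI_edges[OF G])
    show "?v ` verts G \<subseteq> verts ?G" by (auto simp: vG)
    show "inj_on ?v (verts G)" using xy by (auto simp: inj_on_def)
  next
    fix e assume e: "e \<in> edges G"
    from cases[OF e] show "\<exists>u w. e = {u, w} \<and> subgraph (?e e) ?G \<and> is_path (?e e) (?v u) (?v w)"
    proof (elim disjE)
      assume n: "v \<notin> e"
      then have "e \<in> edges ?G" using e by (auto simp: eG)
      from edge_graph_embedding_step[OF G e G' this] obtain z w where
        zw: "e = {z, w}" "subgraph (edge_graph e) ?G" "is_path (edge_graph e) z w" by blast
      moreover have "?v z = z" "?v w = w" using zw n by auto
      ultimately show ?thesis unfolding e0[OF n] by metis
    next
      assume e: "e = {v, a}" show ?thesis unfolding e ev by (intro exI[of _ v] exI[of _ a] conjI refl p1 s1)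
    next
      assume e: "e = {v, b}" show ?thesis unfolding e ev by (intro exI[of _ v] exI[of _ b] conjI refl p1 s1)
    next
      assume e: "e = {v, d}" show ?thesis unfolding e ev by (intro exI[of _ v] exI[of _ d] conjI refl p1 s1)
    qed
  next
    fix e1 e2 assume e: "e1 \<in> edges G" "e2 \<in> edges G" "e1 \<noteq> e2"
    show "verts (?e e1) \<inter> verts (?e e2) \<subseteq> ?v ` (e1 \<inter> e2)"
      using cases[OF e(1)] cases[OF e(2)] e(3) xyg[OF e(1)] xyg[OF e(2)] V neq dist
      by (elim disjE) (simp_all del: fun_upd_apply add: ev e0, auto)
  next
    fix w e assume w: "w \<in> verts G" and e: "e \<in> edges G" and m: "?v w \<in> verts (?e e)"
    have m': "w = v \<and> y \<in> verts (?e e) \<or> w \<noteq> v \<and> w \<in> verts (?e e)"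
      using m by (cases "w = v") auto
    have "w \<noteq> x" "w \<noteq> y" using w xy by auto
    then show "w \<in> e" using cases[OF e] xyg[OF e] m' V neq dist
      by (elim disjE) (simp_all del: fun_upd_apply add: ev e0, auto)
  qed
qed

text \<open>Subdivide \<open>ua\<close> by \<open>x\<close> and \<open>vd\<close> by \<open>y\<close>, and join \<open>x\<close> to \<open>y\<close>. Deleting the edge \<open>uv\<close> leaves a
  subdivision of \<open>G\<close> in which \<open>y\<close> and \<open>x\<close> play the roles of \<open>v\<close> and \<open>u\<close>.\<close>

lemma reroute_opposite_embedding:
  assumes G: "simple_graph G"
    and v: "{v, u} \<in> edges G" "{v, b} \<in> edges G" "{v, d} \<in> edges G" "{u, a} \<in> edges G" "{u, w} \<in> edges G"
    and dist: "distinct [u, b, d]" "distinct [v, a, w]"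
    and nbv: "\<And>e. e \<in> edges G \<Longrightarrow> v \<in> e \<Longrightarrow> e \<in> {{v, u}, {v, b}, {v, d}}"
    and nbu: "\<And>e. e \<in> edges G \<Longrightarrow> u \<in> e \<Longrightarrow> e \<in> {{v, u}, {u, a}, {u, w}}"
    and xy: "x \<notin> verts G" "y \<notin> verts G" "x \<noteq> y"
  shows "homeo_embedding (id(v := y, u := x))
    (edge_graph({v, u} := path_graph [y, x], {v, b} := path_graph [y, v, b], {v, d} := path_graph [y, d],
      {u, a} := path_graph [x, a], {u, w} := path_graph [x, u, w]))
    G (plus_edge G {u, a} {v, d} x y)" (is "homeo_embedding ?v ?e G ?G")
proof -
  have V: "v \<in> verts G" "u \<in> verts G" "a \<in> verts G" "b \<in> verts G" "d \<in> verts G" "w \<in> verts G"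
      "v \<noteq> u" "v \<noteq> b" "v \<noteq> d" "u \<noteq> a" "u \<noteq> w"
    using edge_subset[OF G v(1)] edge_subset[OF G v(2)] edge_subset[OF G v(3)] edge_subset[OF G v(4)] edge_subset[OF G v(5)]
      edge_card[OF G v(1)] edge_card[OF G v(2)] edge_card[OF G v(3)] edge_card[OF G v(4)] edge_card[OF G v(5)] by auto
  have neq: "x \<noteq> v" "y \<noteq> v" "x \<noteq> a" "x \<noteq> b" "x \<noteq> d" "y \<noteq> a" "y \<noteq> b" "y \<noteq> d"
    "x \<noteq> u" "y \<noteq> u" "x \<noteq> w" "y \<noteq> w" using V xy by auto
  have ne: "{u, a} \<noteq> {v, d}" using dist V by (auto simp: doubleton_eq_iff)
  have G': "simple_graph ?G" by (rule simple_plus_edge[OF G v(4,3) ne xy])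
  note vG = plus_edge_sel(1)[of G u a v d x y]
  note eG = plus_edge_sel(2)[of G u a v d x y]
  have neqs: "{v, u} \<noteq> {v, b}" "{v, u} \<noteq> {v, d}" "{v, u} \<noteq> {u, a}" "{v, u} \<noteq> {u, w}"
    "{v, b} \<noteq> {v, d}" "{v, b} \<noteq> {u, a}" "{v, b} \<noteq> {u, w}" "{v, d} \<noteq> {u, a}" "{v, d} \<noteq> {u, w}" "{u, a} \<noteq> {u, w}"
    using dist V by (auto simp: doubleton_eq_iff)
  have ev: "?e {v, u} = path_graph [y, x]" "?e {v, b} = path_graph [y, v, b]" "?e {v, d} = path_graph [y, d]"
      "?e {u, a} = path_graph [x, a]" "?e {u, w} = path_graph [x, u, w]"
    using neqs by auto
  have e0: "?e g = edge_graph g" if "v \<notin> g" "u \<notin> g" for g using that by auto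
  have xyg: "x \<notin> g" "y \<notin> g" if "g \<in> edges G" for g using edge_subset[OF G that] xy by auto
  have cases: "v \<notin> g \<and> u \<notin> g \<or> g = {v, u} \<or> g = {v, b} \<or> g = {v, d} \<or> g = {u, a} \<or> g = {u, w}"
    if "g \<in> edges G" for g
    using nbv[OF that] nbu[OF that] by auto
  have p1: "is_path (path_graph [y, x]) (?v v) (?v u)" "is_path (path_graph [y, v, b]) (?v v) (?v b)"
    "is_path (path_graph [y, d]) (?v v) (?v d)" "is_path (path_graph [x, a]) (?v u) (?v a)"
    "is_path (path_graph [x, u, w]) (?v u) (?v w)"
    using V neq xy dist by (auto intro!: is_pathI)
  have s1: "subgraph (path_graph [y, x]) ?G" "subgraph (path_graph [y, v, b]) ?G"
    "subgraph (path_graph [y, d]) ?G" "subgraph (path_graph [x, a]) ?G" "subgraph (path_graph [x, u, w]) ?G"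
    using V neq xy v dist by (intro subgraph_path_graph[OF G']; simp add: vG eG doubleton_eq_iff; blast)+
  have rev: "b \<noteq> u" "d \<noteq> u" "a \<noteq> v" "w \<noteq> v" "u \<noteq> v" "b \<noteq> v" "d \<noteq> v" "a \<noteq> u" "w \<noteq> u"
    "d \<noteq> b" "w \<noteq> a" using V dist by auto
  \<comment> \<open>A closed form avoids a case split over pairs of edges: \<open>y\<close> and
    \<open>x\<close> take over as branch vertices, while the old \<open>v\<close> becomes interior
    to the image of \<open>vb\<close> and the old \<open>u\<close> to that of
    \<open>uw\<close>.\<close>
  have mem: "verts (?e e) = (if v \<in> e then {y} else {}) \<union> (if u \<in> e then {x} else {})
      \<union> (if e = {v, b} then {v} else {}) \<union> (if e = {u, w} then {u} else {}) \<union> (e - {u, v})"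
    if "e \<in> edges G" for e
    using cases[OF that]
  proof (elim disjE)
    assume n: "v \<notin> e \<and> u \<notin> e"
    then have "e \<noteq> {v, b}" "e \<noteq> {u, w}" by auto
    then show ?thesis unfolding e0[OF conjunct1[OF n] conjunct2[OF n]] using n by simp
  next
    assume e: "e = {v, u}" show ?thesis unfolding e ev using V dist rev neqs neqs[symmetric]
      by (simp add: insert_Diff_if insert_commute)
  next
    assume e: "e = {v, b}" show ?thesis unfolding e ev using V dist rev neqs neqs[symmetric]
      by (simp add: insert_Diff_if insert_commute)
  next
    assume e: "e = {v, d}" show ?thesis unfolding e ev using V dist rev neqs neqs[symmetric]
      by (simp add: insert_Diff_if insert_commute)
  next
    assume e: "e = {u, a}" show ?thesis unfolding e ev using V dist rev neqs neqs[symmetric]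
      by (simp add: insert_Diff_if insert_commute)
  next
    assume e: "e = {u, w}" show ?thesis unfolding e ev using V dist rev neqs neqs[symmetric]
      by (simp add: insert_Diff_if insert_commute)
  qed
  show ?thesis
  proof (rule homeo_embeddingI_edges[OF G])
    show "?v ` verts G \<subseteq> verts ?G" by (auto simp: vG)
    show "inj_on ?v (verts G)" using xy by (auto simp: inj_on_def)
  next
    fix e assume e: "e \<in> edges G"
    from cases[OF e] show "\<exists>u w. e = {u, w} \<and> subgraph (?e e) ?G \<and> is_path (?e e) (?v u) (?v w)"
    proof (elim disjE)
      assume n: "v \<notin> e \<and> u \<notin> e"
      then have "e \<in> edges ?G" using e by (auto simp: eG)
      from edge_graph_embedding_step[OF G e G' this] obtain z t where
        zt: "e = {z, t}" "subgraph (edge_graph e) ?G" "is_path (edge_graph e) z t" by blast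
      moreover have "?v z = z" "?v t = t" using zt n by auto
      ultimately show ?thesis unfolding e0[OF conjunct1[OF n] conjunct2[OF n]] by metis
    next
      assume e: "e = {v, u}" show ?thesis unfolding e ev by (intro exI[of _ v] exI[of _ u] conjI refl p1 s1)
    next
      assume e: "e = {v, b}" show ?thesis unfolding e ev by (intro exI[of _ v] exI[of _ b] conjI refl p1 s1)
    next
      assume e: "e = {v, d}" show ?thesis unfolding e ev by (intro exI[of _ v] exI[of _ d] conjI refl p1 s1)
    next
      assume e: "e = {u, a}" show ?thesis unfolding e ev by (intro exI[of _ u] exI[of _ a] conjI refl p1 s1)
    next
      assume e: "e = {u, w}" show ?thesis unfolding e ev by (intro exI[of _ u] exI[of _ w] conjI refl p1 s1)
    qed
  next
    fix e1 e2 assume e: "e1 \<in> edges G" "e2 \<in> edges G" "e1 \<noteq> e2"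
    show "verts (?e e1) \<inter> verts (?e e2) \<subseteq> ?v ` (e1 \<inter> e2)"
    proof
      fix z assume "z \<in> verts (?e e1) \<inter> verts (?e e2)"
      then have z: "z \<in> verts (?e e1)" "z \<in> verts (?e e2)" by auto
      have g: "x \<notin> e1" "y \<notin> e1" "x \<notin> e2" "y \<notin> e2" using xyg e by auto
      consider "z = y" | "z = x" | "z = v" | "z = u" | "z \<notin> {x, y, v, u}" by auto
      then have "\<exists>w. w \<in> e1 \<inter> e2 \<and> ?v w = z"
      proof cases
        case 1 then show ?thesis using z g neq xy rev unfolding mem[OF e(1)] mem[OF e(2)]
          by (intro exI[of _ v]) (auto split: if_splits)
      next
        case 2 then show ?thesis using z g neq xy rev unfolding mem[OF e(1)] mem[OF e(2)]
          by (intro exI[of _ u]) (auto split: if_splits)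
      next
        case 3 then show ?thesis using z neq V e(3) unfolding mem[OF e(1)] mem[OF e(2)]
          by (auto split: if_splits)
      next
        case 4 then show ?thesis using z neq V e(3) unfolding mem[OF e(1)] mem[OF e(2)]
          by (auto split: if_splits)
      next
        case 5 then show ?thesis using z unfolding mem[OF e(1)] mem[OF e(2)]
          by (intro exI[of _ z]) (auto split: if_splits)
      qed
      then show "z \<in> ?v ` (e1 \<inter> e2)" by blast
    qed
  next
    fix z e assume z: "z \<in> verts G" and e: "e \<in> edges G" and m: "?v z \<in> verts (?e e)"
    have zn: "z \<noteq> x" "z \<noteq> y" using z xy by auto
    consider "z = v" | "z = u" | "z \<notin> {v, u}" by auto
    then show "z \<in> e"
    proof cases
      case 1
      then have "y \<in> verts (?e e)" using m V by simp
      then show ?thesis using 1 xy neq xyg[OF e] unfolding mem[OF e] by (auto split: if_splits)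
    next
      case 2
      then have "x \<in> verts (?e e)" using m by simp
      then show ?thesis using 2 xy neq xyg[OF e] unfolding mem[OF e] by (auto split: if_splits)
    next
      case 3
      then have "z \<in> verts (?e e)" using m by simp
      then show ?thesis using 3 zn unfolding mem[OF e] by (auto split: if_splits)
    qed
  qed
qed

section \<open>Rerouting an embedding along an \<eta>-path of \<open>H\<close>\<close>

text \<open>By means of \<open>Q\<close> the graph \<open>G + (va, vd)\<close> embeds in
  \<open>H\<close>; composing with the embedding of \<open>G\<close> in that graph moves the branch
  vertex of \<open>v\<close> to \<open>t\<close>. The image of \<open>vd\<close> shrinks to its
  tail, and the part cut off goes to the image of \<open>vb\<close>. The infinite vertex type
  supplies \<open>x\<close> and \<open>y\<close>.\<close>

lemma reroute_adjacent:
  fixes G :: "'a::infinite ugraph"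
  assumes \<eta>: "homeo_embedding \<eta>v \<eta>e G H" and G: "simple_graph G" and H: "simple_graph H"
    and v: "{v, a} \<in> edges G" "{v, b} \<in> edges G" "{v, d} \<in> edges G"
    and dist: "distinct [a, b, d]"
    and nb: "\<And>e. e \<in> edges G \<Longrightarrow> v \<in> e \<Longrightarrow> e \<in> {{v, a}, {v, b}, {v, d}}"
    and P: "\<eta>e {v, a} = path_graph (p @ s # q)" "distinct (p @ s # q)" "p \<noteq> []" "q \<noteq> []"
      "hd p = \<eta>v v" "last q = \<eta>v a"
    and P': "\<eta>e {v, d} = path_graph (p' @ t # q')" "distinct (p' @ t # q')" "p' \<noteq> []" "q' \<noteq> []"
      "hd p' = \<eta>v v" "last q' = \<eta>v d"
    and Q: "distinct Q" "Q \<noteq> []" "hd Q = s" "last Q = t" "set Q \<subseteq> verts H" "path_edges Q \<subseteq> edges H"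
      "set Q \<inter> embedded_verts \<eta>v \<eta>e G \<subseteq> {s, t}"
  obtains \<eta>v' \<eta>e' where "homeo_embedding \<eta>v' \<eta>e' G H" "\<eta>v' v = t"
    "\<And>w. w \<in> verts G \<Longrightarrow> w \<noteq> v \<Longrightarrow> \<eta>v' w = \<eta>v w" "\<eta>e' {v, d} = path_graph (t # q')"
    "\<And>g. g \<in> edges G \<Longrightarrow> v \<notin> g \<Longrightarrow> \<eta>e' g = \<eta>e g"
proof -
  have "finite (verts G)" using G by (simp add: simple_graph_def)
  then obtain x where x: "x \<notin> verts G" using ex_new_if_finite infinite_UNIV by blast
  then obtain y where y: "y \<notin> verts G" "x \<noteq> y"
    using ex_new_if_finite[of "insert x (verts G)"] infinite_UNIV \<open>finite (verts G)\<close> by auto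
  note xy = x y
  have V: "v \<in> verts G" "d \<in> verts G" "v \<noteq> d" using v edge_subset[OF G] edge_card[OF G v(3)] by auto
  have ne: "{v, a} \<noteq> {v, d}" "{v, b} \<noteq> {v, d}" "{v, a} \<noteq> {v, b}" using dist by (auto simp: doubleton_eq_iff)
  let ?\<alpha>e = "edge_graph({v, a} := path_graph [y, x, a], {v, b} := path_graph [y, v, b], {v, d} := path_graph [y, d])"
  let ?\<beta>v = "\<eta>v(x := s, y := t)"
  let ?\<beta>e = "\<eta>e({x, v} := path_graph (p @ [s]), {x, a} := path_graph (s # q),
        {y, v} := path_graph (p' @ [t]), {y, d} := path_graph (t # q'), {x, y} := path_graph Q)"
  have \<alpha>: "homeo_embedding (id(v := y)) ?\<alpha>e G (plus_edge G {v, a} {v, d} x y)"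
    by (rule reroute_adjacent_embedding[OF G v dist nb xy])
  have \<beta>: "homeo_embedding ?\<beta>v ?\<beta>e (plus_edge G {v, a} {v, d} x y) H"
    by (rule plus_edge_embedding[OF \<eta> G H v(1,3) ne(1) xy P P' Q])
  let ?v = "?\<beta>v \<circ> id(v := y)" and ?e = "\<lambda>e. lift_edges ?\<beta>e (edges (?\<alpha>e e))"
  have h: "homeo_embedding ?v ?e G H"
    by (rule homeo_embedding_comp[OF \<alpha> \<beta> G simple_plus_edge[OF G v(1,3) ne(1) xy] H])
  have 1: "?v v = t" by simp
  have 2: "?v w = \<eta>v w" if "w \<in> verts G" "w \<noteq> v" for w using that xy by auto
  have 3: "?e {v, d} = path_graph (t # q')"
  proof -
    have "?\<alpha>e {v, d} = path_graph [y, d]" by simp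
    moreover have "?\<beta>e {y, d} = path_graph (t # q')" using V xy by (auto simp: doubleton_eq_iff)
    ultimately show ?thesis by (simp del: fun_upd_apply)
  qed
  have 4: "?e g = \<eta>e g" if "g \<in> edges G" "v \<notin> g" for g
  proof -
    have "?\<alpha>e g = edge_graph g" using that by auto
    moreover have "x \<notin> g" "y \<notin> g" using edge_subset[OF G that(1)] xy by auto
    then have "?\<beta>e g = \<eta>e g" by auto
    ultimately show ?thesis by (simp del: fun_upd_apply)
  qed
  show ?thesis using that[OF h 1 2 3 4] by blast
qed

text \<open>The same composition through \<open>G + (ua, vd)\<close>. Here two branch vertices move,
  and the image of \<open>uw\<close> grows by the piece of \<open>\<eta>e {u, a}\<close> between the
  old and the new branch vertex of \<open>u\<close>. The conclusion records this piece because it is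
  the only source of new forward arcs.\<close>

lemma reroute_opposite:
  fixes G :: "'a::infinite ugraph"
  assumes \<eta>: "homeo_embedding \<eta>v \<eta>e G H" and G: "simple_graph G" and H: "simple_graph H"
    and v: "{v, u} \<in> edges G" "{v, b} \<in> edges G" "{v, d} \<in> edges G" "{u, a} \<in> edges G" "{u, w} \<in> edges G"
    and dist: "distinct [u, b, d]" "distinct [v, a, w]"
    and nbv: "\<And>e. e \<in> edges G \<Longrightarrow> v \<in> e \<Longrightarrow> e \<in> {{v, u}, {v, b}, {v, d}}"
    and nbu: "\<And>e. e \<in> edges G \<Longrightarrow> u \<in> e \<Longrightarrow> e \<in> {{v, u}, {u, a}, {u, w}}"
    and P: "\<eta>e {u, a} = path_graph (p @ s # q)" "distinct (p @ s # q)" "p \<noteq> []" "q \<noteq> []"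
      "hd p = \<eta>v u" "last q = \<eta>v a"
    and P': "\<eta>e {v, d} = path_graph (p' @ t # q')" "distinct (p' @ t # q')" "p' \<noteq> []" "q' \<noteq> []"
      "hd p' = \<eta>v v" "last q' = \<eta>v d"
    and Q: "distinct Q" "Q \<noteq> []" "hd Q = s" "last Q = t" "set Q \<subseteq> verts H" "path_edges Q \<subseteq> edges H"
      "set Q \<inter> embedded_verts \<eta>v \<eta>e G \<subseteq> {s, t}"
  obtains \<eta>v' \<eta>e' where "homeo_embedding \<eta>v' \<eta>e' G H" "\<eta>v' v = t" "\<eta>v' u = s"
    "\<And>w. w \<in> verts G \<Longrightarrow> w \<noteq> v \<Longrightarrow> w \<noteq> u \<Longrightarrow> \<eta>v' w = \<eta>v w" "\<eta>e' {v, d} = path_graph (t # q')"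
    "\<eta>e' {u, w} = graph_union (path_graph (p @ [s])) (\<eta>e {u, w})"
    "\<And>g. g \<in> edges G \<Longrightarrow> v \<notin> g \<Longrightarrow> u \<notin> g \<Longrightarrow> \<eta>e' g = \<eta>e g"
proof -
  have "finite (verts G)" using G by (simp add: simple_graph_def)
  then obtain x where x: "x \<notin> verts G" using ex_new_if_finite infinite_UNIV by blast
  then obtain y where y: "y \<notin> verts G" "x \<noteq> y"
    using ex_new_if_finite[of "insert x (verts G)"] infinite_UNIV \<open>finite (verts G)\<close> by auto
  note xy = x y
  have V: "v \<in> verts G" "d \<in> verts G" "v \<noteq> d" "u \<in> verts G" "a \<in> verts G" "w \<in> verts G" "u \<noteq> v" "u \<noteq> w" "u \<noteq> a"
    using v edge_subset[OF G] edge_card[OF G v(3)] edge_card[OF G v(1)] edge_card[OF G v(5)] edge_card[OF G v(4)] by auto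
  have ne: "{u, a} \<noteq> {v, d}" "{u, w} \<noteq> {v, d}" "{u, a} \<noteq> {u, w}" using dist V by (auto simp: doubleton_eq_iff)
  let ?\<alpha>e = "edge_graph({v, u} := path_graph [y, x], {v, b} := path_graph [y, v, b], {v, d} := path_graph [y, d],
      {u, a} := path_graph [x, a], {u, w} := path_graph [x, u, w])"
  let ?\<beta>v = "\<eta>v(x := s, y := t)"
  let ?\<beta>e = "\<eta>e({x, u} := path_graph (p @ [s]), {x, a} := path_graph (s # q),
        {y, v} := path_graph (p' @ [t]), {y, d} := path_graph (t # q'), {x, y} := path_graph Q)"
  have \<alpha>: "homeo_embedding (id(v := y, u := x)) ?\<alpha>e G (plus_edge G {u, a} {v, d} x y)"
    by (rule reroute_opposite_embedding[OF G v dist nbv nbu xy])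
  have \<beta>: "homeo_embedding ?\<beta>v ?\<beta>e (plus_edge G {u, a} {v, d} x y) H"
    by (rule plus_edge_embedding[OF \<eta> G H v(4,3) ne(1) xy P P' Q])
  let ?v = "?\<beta>v \<circ> id(v := y, u := x)" and ?e = "\<lambda>e. lift_edges ?\<beta>e (edges (?\<alpha>e e))"
  have h: "homeo_embedding ?v ?e G H"
    by (rule homeo_embedding_comp[OF \<alpha> \<beta> G simple_plus_edge[OF G v(4,3) ne(1) xy] H])
  have 1: "?v v = t" using V xy by simp
  have 2: "?v u = s" using V xy by simp
  have 3: "?v w = \<eta>v w" if "w \<in> verts G" "w \<noteq> v" "w \<noteq> u" for w using that xy by auto
  have 4: "?e {v, d} = path_graph (t # q')"
  proof -
    have "?\<alpha>e {v, d} = path_graph [y, d]" using ne by simp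
    moreover have "?\<beta>e {y, d} = path_graph (t # q')" using V xy by (auto simp: doubleton_eq_iff)
    ultimately show ?thesis by (simp del: fun_upd_apply)
  qed
  have 5: "?e {u, w} = graph_union (path_graph (p @ [s])) (\<eta>e {u, w})"
  proof -
    have "?\<alpha>e {u, w} = path_graph [x, u, w]" by simp
    moreover have "?\<beta>e {x, u} = path_graph (p @ [s])" using V xy dist by (auto simp: doubleton_eq_iff)
    moreover have "?\<beta>e {u, w} = \<eta>e {u, w}" using V xy by (auto simp: doubleton_eq_iff)
    ultimately show ?thesis by (simp del: fun_upd_apply add: lift_edges_insert[of _ "{x, u}"])
  qed
  have 6: "?e g = \<eta>e g" if "g \<in> edges G" "v \<notin> g" "u \<notin> g" for g
  proof -
    have "?\<alpha>e g = edge_graph g" using that by auto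
    moreover have "x \<notin> g" "y \<notin> g" using edge_subset[OF G that(1)] xy by auto
    then have "?\<beta>e g = \<eta>e g" by auto
    ultimately show ?thesis by (simp del: fun_upd_apply)
  qed
  show ?thesis using that[OF h 1 2 3 4 5 6] by blast
qed

section \<open>Orientation of the paths that leave the image of \<open>C\<close>\<close>

definition consecutive :: "'a list \<Rightarrow> 'a \<Rightarrow> 'a \<Rightarrow> bool" where
  "consecutive p v w \<longleftrightarrow> (\<exists>i. Suc i < length p \<and> v = p ! i \<and> w = p ! Suc i)"

lemma consecutive_appendI: "consecutive q v w \<Longrightarrow> consecutive (p @ q) v w"
proof -
  assume "consecutive q v w"
  then obtain i where "Suc i < length q" "v = q ! i" "w = q ! Suc i" by (auto simp: consecutive_def)
  then show ?thesis unfolding consecutive_def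
    by (intro exI[of _ "length p + i"]) (simp add: nth_append)
qed

lemma consecutive_appendD: "consecutive (p @ x # q) v w \<Longrightarrow> consecutive (p @ [x]) v w \<or> consecutive (x # q) v w"
proof -
  assume "consecutive (p @ x # q) v w"
  then obtain i where i: "Suc i < length (p @ x # q)" "v = (p @ x # q) ! i" "w = (p @ x # q) ! Suc i"
    by (auto simp: consecutive_def)
  show ?thesis
  proof (cases "i < length p")
    case True
    then have "Suc i < length (p @ [x])" "v = (p @ [x]) ! i" "w = (p @ [x]) ! Suc i"
      using i by (auto simp: nth_append not_less less_Suc_eq)
    then show ?thesis by (auto simp: consecutive_def)
  next
    case False
    then have "Suc (i - length p) < length (x # q)" "v = (x # q) ! (i - length p)" "w = (x # q) ! Suc (i - length p)"
      using i by (auto simp: nth_append not_less Suc_diff_le)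
    then show ?thesis by (auto simp: consecutive_def)
  qed
qed

lemma consecutive_mem: "consecutive p v w \<Longrightarrow> v \<in> set p \<and> w \<in> set p \<and> {v, w} \<in> path_edges p"
  by (auto simp: consecutive_def path_edges_def)

text \<open>The arcs of the paths from the image of \<open>C\<close> outwards, directed away from
  it; in flow terms, the arcs that carry flow. Since a path graph has no direction,
  \<open>hd p = \<eta>v c\<close> selects the list to be read.\<close>

definition forward ::
    "('a \<Rightarrow> 'b) \<Rightarrow> ('a set \<Rightarrow> 'b ugraph) \<Rightarrow> 'a ugraph \<Rightarrow> 'a ugraph \<Rightarrow> 'b \<Rightarrow> 'b \<Rightarrow> bool" where
  "forward \<eta>v \<eta>e G C v w \<longleftrightarrow>
     (\<exists>c \<in> verts C. \<exists>d p. d \<notin> verts C \<and> {c, d} \<in> edges G \<and> \<eta>e {c, d} = path_graph p \<and>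
        distinct p \<and> p \<noteq> [] \<and> hd p = \<eta>v c \<and> consecutive p v w)"

text \<open>The local facts about a circuit of length four, without a cyclic numbering of its
  vertices. \<open>nbrs\<close> includes that \<open>C\<close> has no chord. \<open>opposite\<close>
  reflects the length: an edge of \<open>C\<close> that misses \<open>v\<close> has an end next to
  \<open>v\<close>, and writing it as \<open>{u, a}\<close> singles out such an end.\<close>

locale quadrangle =
  fixes G C :: "'a::infinite ugraph"
  assumes simple: "simple_graph G"
    and CG: "verts C \<subseteq> verts G" "edges C \<subseteq> edges G"
    and nbrs: "\<And>c. c \<in> verts C \<Longrightarrow> \<exists>a b d. distinct [a, b, d] \<and> a \<in> verts C \<and> b \<in> verts C \<and> d \<notin> verts C \<and>
      {c, a} \<in> edges C \<and> {c, b} \<in> edges C \<and> {c, d} \<in> edges G \<and>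
      (\<forall>e \<in> edges G. c \<in> e \<longrightarrow> e \<in> {{c, a}, {c, b}, {c, d}})"
    and opposite: "\<And>e v. e \<in> edges C \<Longrightarrow> v \<in> verts C \<Longrightarrow> v \<notin> e \<Longrightarrow>
      \<exists>u a. e = {u, a} \<and> {v, u} \<in> edges C"
    and C_edge: "\<And>e. e \<in> edges C \<Longrightarrow> e \<subseteq> verts C"
begin

lemma nbrs_of:
  assumes "c \<in> verts C" "{c, a} \<in> edges C" "{c, d} \<in> edges G" "d \<notin> verts C"
  obtains b where "distinct [a, b, d]" "a \<in> verts C" "b \<in> verts C" "{c, b} \<in> edges C"
    "\<And>e. e \<in> edges G \<Longrightarrow> c \<in> e \<Longrightarrow> e \<in> {{c, a}, {c, b}, {c, d}}"
proof -
  obtain a' b' d' where n: "distinct [a', b', d']" "a' \<in> verts C" "b' \<in> verts C" "d' \<notin> verts C"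
      "{c, a'} \<in> edges C" "{c, b'} \<in> edges C" "{c, d'} \<in> edges G"
      "\<And>e. e \<in> edges G \<Longrightarrow> c \<in> e \<Longrightarrow> e \<in> {{c, a'}, {c, b'}, {c, d'}}"
    using nbrs[OF assms(1)] by metis
  have a: "a \<in> verts C" using C_edge[OF assms(2)] by simp
  have "d' = d" using n(8)[OF assms(3)] n assms by (auto simp: doubleton_eq_iff)
  have "{c, a} \<in> edges G" using assms CG by auto
  then have "a = a' \<or> a = b'" using n(8)[of "{c, a}"] a n assms(1) by (auto simp: doubleton_eq_iff)
  then show ?thesis
  proof
    assume "a = a'" then show ?thesis using that[of b'] n \<open>d' = d\<close> by auto
  next
    assume "a = b'" then show ?thesis using that[of a'] n \<open>d' = d\<close> by auto
  qed
qed

lemma outer_unique: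
  assumes "c \<in> verts C" "{c, d} \<in> edges G" "d \<notin> verts C" "{c, d'} \<in> edges G" "d' \<notin> verts C"
  shows "d = d'"
proof -
  obtain a b d0 where n: "a \<in> verts C" "b \<in> verts C"
      "\<And>e. e \<in> edges G \<Longrightarrow> c \<in> e \<Longrightarrow> e \<in> {{c, a}, {c, b}, {c, d0}}"
    using nbrs[OF assms(1)] by metis
  then show ?thesis using n(3)[OF assms(2)] n(3)[OF assms(4)] assms by (auto simp: doubleton_eq_iff)
qed

definition core :: "('a set \<Rightarrow> 'b ugraph) \<Rightarrow> 'b set" where
  "core \<eta>e = (\<Union>e\<in>edges C. verts (\<eta>e e))"

end

lemma split_interior:
  assumes "homeo_embedding \<eta>v \<eta>e G H" "{a, b} \<in> edges G" "s \<in> verts (\<eta>e {a, b})" "s \<noteq> \<eta>v a" "s \<noteq> \<eta>v b"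
  obtains p q where "\<eta>e {a, b} = path_graph (p @ s # q)" "distinct (p @ s # q)" "p \<noteq> []" "q \<noteq> []"
      "hd p = \<eta>v a" "last q = \<eta>v b"
proof -
  obtain r where r: "r \<noteq> []" "distinct r" "hd r = \<eta>v a" "last r = \<eta>v b" "\<eta>e {a, b} = path_graph r"
    using homeo_embedding_path[OF assms(1,2)] by (rule is_pathE)
  then obtain p q where pq: "r = p @ s # q" using assms(3) split_list by fastforce
  then have "p \<noteq> []" "q \<noteq> []" using r assms(4,5) by auto
  then show ?thesis using that[of p q] r pq by auto
qed

text \<open>If \<open>e\<close> ends at \<open>c\<close>, then \<open>c\<close> moves to
  \<open>t\<close>, the outer path at \<open>c\<close> becomes its own tail and the other outer
  paths stay. Otherwise \<open>e\<close> has an end \<open>u\<close> next to \<open>c\<close>; then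
  \<open>u\<close> moves as well, to \<open>s\<close>, and its outer path gains an initial piece of
  the image of \<open>e\<close>. This piece causes the alternative
  \<open>x \<in> core \<eta>e\<close> in the conclusion.\<close>

lemma (in quadrangle) reroute:
  fixes \<eta>v :: "'a \<Rightarrow> 'b" and H :: "'b ugraph"
  assumes \<eta>: "homeo_embedding \<eta>v \<eta>e G H" and H: "simple_graph H"
    and e: "e \<in> edges C" and s: "s \<in> verts (\<eta>e e)" "s \<notin> \<eta>v ` verts G"
    and c: "c \<in> verts C" "d \<notin> verts C" "{c, d} \<in> edges G"
    and t: "t \<in> verts (\<eta>e {c, d})" "t \<notin> \<eta>v ` verts G"
    and Q: "distinct Q" "Q \<noteq> []" "hd Q = s" "last Q = t" "set Q \<subseteq> verts H" "path_edges Q \<subseteq> edges H"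
      "set Q \<inter> embedded_verts \<eta>v \<eta>e G \<subseteq> {s, t}"
  shows "\<exists>\<eta>v' \<eta>e'. homeo_embedding \<eta>v' \<eta>e' G H \<and>
    (\<forall>w \<in> verts G - verts C. \<eta>v' w = \<eta>v w) \<and> (\<forall>g \<in> edges G. g \<inter> verts C = {} \<longrightarrow> \<eta>e' g = \<eta>e g) \<and>
    t \<in> core \<eta>e' \<and> (\<forall>x y. forward \<eta>v' \<eta>e' G C x y \<longrightarrow> forward \<eta>v \<eta>e G C x y \<or> x \<in> core \<eta>e)"
proof -
  have branch: "\<eta>v w \<noteq> s" "\<eta>v w \<noteq> t" if "w \<in> verts G" for w using s t that by auto
  have cG: "c \<in> verts G" "d \<in> verts G" using edge_subset[OF simple c(3)] by auto
  obtain p' q' where P': "\<eta>e {c, d} = path_graph (p' @ t # q')" "distinct (p' @ t # q')" "p' \<noteq> []" "q' \<noteq> []"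
      "hd p' = \<eta>v c" "last q' = \<eta>v d"
    using split_interior[OF \<eta> c(3) t(1)] branch(2)[OF cG(1)] branch(2)[OF cG(2)] by metis
  show ?thesis
  proof (cases "c \<in> e")
    case True
    obtain x y where "e = {x, y}" using edge_doubleton[OF simple, of e] CG e by blast
    then obtain a where a: "e = {c, a}" using True by (auto simp: insert_commute)
    have ca: "{c, a} \<in> edges C" "{c, a} \<in> edges G" using a e CG by auto
    have aG: "a \<in> verts G" using edge_subset[OF simple ca(2)] by auto
    obtain b where b: "distinct [a, b, d]" "{c, b} \<in> edges C"
      "\<And>e. e \<in> edges G \<Longrightarrow> c \<in> e \<Longrightarrow> e \<in> {{c, a}, {c, b}, {c, d}}"
      using nbrs_of[OF c(1) ca(1) c(3,2)] by metis
    obtain p q where P: "\<eta>e {c, a} = path_graph (p @ s # q)" "distinct (p @ s # q)" "p \<noteq> []" "q \<noteq> []"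
        "hd p = \<eta>v c" "last q = \<eta>v a"
      using split_interior[OF \<eta> ca(2)] s(1) branch(1)[OF cG(1)] branch(1)[OF aG] a by metis
    have cb: "{c, b} \<in> edges G" using b CG by auto
    obtain \<eta>v' \<eta>e' where \<eta>': "homeo_embedding \<eta>v' \<eta>e' G H" "\<eta>v' c = t"
      "\<And>w. w \<in> verts G \<Longrightarrow> w \<noteq> c \<Longrightarrow> \<eta>v' w = \<eta>v w" "\<eta>e' {c, d} = path_graph (t # q')"
      "\<And>g. g \<in> edges G \<Longrightarrow> c \<notin> g \<Longrightarrow> \<eta>e' g = \<eta>e g"
      using reroute_adjacent[OF \<eta> simple H ca(2) cb c(3) b(1,3) P P' Q] by blast
    have "t \<in> verts (\<eta>e' {c, a})"
      using homeo_embedding_incident[OF \<eta>'(1) cG(1) ca(2)] \<eta>'(2) by simp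
    then have core: "t \<in> core \<eta>e'" using ca by (auto simp: core_def)
    have "forward \<eta>v \<eta>e G C x y" if fw: "forward \<eta>v' \<eta>e' G C x y" for x y
    proof -
      obtain c' d' r where r: "c' \<in> verts C" "d' \<notin> verts C" "{c', d'} \<in> edges G" "\<eta>e' {c', d'} = path_graph r"
        "distinct r" "r \<noteq> []" "hd r = \<eta>v' c'" "consecutive r x y"
        using fw unfolding forward_def by blast
      show ?thesis
      proof (cases "c' = c")
        case True
        then have d: "d' = d" using outer_unique[OF c(1) r(3)[unfolded True] r(2) c(3,2)] by simp
        \<comment> \<open>Both lists start at \<open>t\<close>, the new branch vertex of
          \<open>c\<close>, so the new outer path is a tail of the old one with the same
          direction.\<close>
        have "r = t # q'" using r True d \<eta>' P' by (intro path_graph_unique) auto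
        then have "consecutive (p' @ t # q') x y" using r consecutive_appendI by metis
        then show ?thesis unfolding forward_def using c P' by (intro bexI[of _ c] exI[of _ d] exI[of _ "p' @ t # q'"]) auto
      next
        case False
        have "c' \<in> verts G" using r CG by auto
        moreover have "c \<notin> {c', d'}" using False r c by auto
        ultimately show ?thesis using r \<eta>' False unfolding forward_def by metis
      qed
    qed
    moreover have "\<forall>w \<in> verts G - verts C. \<eta>v' w = \<eta>v w" using \<eta>' c by auto
    moreover have "\<forall>g \<in> edges G. g \<inter> verts C = {} \<longrightarrow> \<eta>e' g = \<eta>e g" using \<eta>' c by auto
    ultimately show ?thesis using \<eta>'(1) core by blast
  next
    case False
    then obtain u a where ua: "e = {u, a}" "{c, u} \<in> edges C" using opposite[OF e c(1)] by metis
    have uC: "u \<in> verts C" using C_edge[OF e] ua by auto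
    have uaC: "{u, a} \<in> edges C" "{u, a} \<in> edges G" "{c, u} \<in> edges G" using ua e CG by auto
    have uaG: "u \<in> verts G" "a \<in> verts G" using edge_subset[OF simple uaC(2)] by auto
    obtain b where b: "distinct [u, b, d]" "{c, b} \<in> edges C"
      "\<And>e. e \<in> edges G \<Longrightarrow> c \<in> e \<Longrightarrow> e \<in> {{c, u}, {c, b}, {c, d}}"
      using nbrs_of[OF c(1) ua(2) c(3,2)] by metis
    obtain w where w0: "{u, w} \<in> edges G" "w \<notin> verts C" using nbrs[OF uC] by metis
    obtain z where z: "distinct [a, z, w]" "{u, z} \<in> edges C" "z \<in> verts C"
      "\<And>e. e \<in> edges G \<Longrightarrow> u \<in> e \<Longrightarrow> e \<in> {{u, a}, {u, z}, {u, w}}"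
      using nbrs_of[OF uC uaC(1) w0] by metis
    have ca: "c \<noteq> a" "c \<noteq> u" using False ua by auto
    have cw: "c \<noteq> w" using w0 c by auto
    have "{c, u} \<in> {{u, a}, {u, z}, {u, w}}" using z(4)[OF uaC(3)] by simp
    \<comment> \<open>\<open>cu\<close> is one of the three edges at \<open>u\<close>. As
      \<open>c\<close> is not on \<open>e\<close> it differs from \<open>a\<close>, and as it is on
      \<open>C\<close> it differs from the outer neighbour \<open>w\<close>.\<close>
    then have zc: "z = c" using ca cw by (auto simp: doubleton_eq_iff)
    have dist: "distinct [c, a, w]" using z(1) zc by auto
    have nbu: "\<And>e. e \<in> edges G \<Longrightarrow> u \<in> e \<Longrightarrow> e \<in> {{c, u}, {u, a}, {u, w}}"
      using z(4) zc by (auto simp: insert_commute)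
    obtain p q where P: "\<eta>e {u, a} = path_graph (p @ s # q)" "distinct (p @ s # q)" "p \<noteq> []" "q \<noteq> []"
        "hd p = \<eta>v u" "last q = \<eta>v a"
      using split_interior[OF \<eta> uaC(2)] s(1) branch(1)[OF uaG(1)] branch(1)[OF uaG(2)] ua by metis
    have cb: "{c, b} \<in> edges G" using b CG by auto
    obtain \<eta>v' \<eta>e' where \<eta>': "homeo_embedding \<eta>v' \<eta>e' G H" "\<eta>v' c = t" "\<eta>v' u = s"
      "\<And>w. w \<in> verts G \<Longrightarrow> w \<noteq> c \<Longrightarrow> w \<noteq> u \<Longrightarrow> \<eta>v' w = \<eta>v w" "\<eta>e' {c, d} = path_graph (t # q')"
      "\<eta>e' {u, w} = graph_union (path_graph (p @ [s])) (\<eta>e {u, w})"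
      "\<And>g. g \<in> edges G \<Longrightarrow> c \<notin> g \<Longrightarrow> u \<notin> g \<Longrightarrow> \<eta>e' g = \<eta>e g"
      using reroute_opposite[OF \<eta> simple H uaC(3) cb c(3) uaC(2) w0(1) b(1) dist b(3) nbu P P' Q] by blast
    have "t \<in> verts (\<eta>e' {c, u})"
      using homeo_embedding_incident[OF \<eta>'(1) cG(1) uaC(3)] \<eta>'(2) by simp
    then have core: "t \<in> core \<eta>e'" using ua by (auto simp: core_def)
    have "forward \<eta>v \<eta>e G C x y \<or> x \<in> core \<eta>e" if fw: "forward \<eta>v' \<eta>e' G C x y" for x y
    proof -
      obtain c' d' r where r: "c' \<in> verts C" "d' \<notin> verts C" "{c', d'} \<in> edges G" "\<eta>e' {c', d'} = path_graph r"
        "distinct r" "r \<noteq> []" "hd r = \<eta>v' c'" "consecutive r x y"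
        using fw unfolding forward_def by blast
      consider "c' = c" | "c' = u" | "c' \<noteq> c" "c' \<noteq> u" by auto
      then show ?thesis
      proof cases
        case 1
        then have d: "d' = d" using outer_unique[OF c(1) r(3)[unfolded 1] r(2) c(3,2)] by simp
        have "r = t # q'" using r 1 d \<eta>' P' by (intro path_graph_unique) auto
        then have "consecutive (p' @ t # q') x y" using r consecutive_appendI by metis
        then have "forward \<eta>v \<eta>e G C x y" unfolding forward_def using c P'
          by (intro bexI[of _ c] exI[of _ d] exI[of _ "p' @ t # q'"]) auto
        then show ?thesis ..
      next
        case 2
        then have d: "d' = w" using outer_unique[OF uC r(3)[unfolded 2] r(2) w0] by simp
        obtain k where k: "k \<noteq> []" "distinct k" "hd k = \<eta>v u" "last k = \<eta>v w" "\<eta>e {u, w} = path_graph k"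
          using homeo_embedding_path[OF \<eta> w0(1)] by (rule is_pathE)
        obtain k' where k': "k = \<eta>v u # k'" using k by (cases k) auto
        obtain p2 where p2: "p = \<eta>v u # p2" using P by (cases p) auto
        have "{u, a} \<noteq> {u, w}" using dist by (auto simp: doubleton_eq_iff)
        then have "set (p @ s # q) \<inter> set k \<subseteq> \<eta>v ` ({u, a} \<inter> {u, w})"
          using homeo_embedding_disjoint[OF \<eta> simple uaC(2) w0(1)] P k by simp
        then have int: "set (p @ s # q) \<inter> set k \<subseteq> {\<eta>v u}" using dist by auto
        \<comment> \<open>The new outer path at \<open>u\<close> runs from \<open>s\<close>
          backwards along \<open>\<eta>e {u, a}\<close> to the old branch vertex and then along the
          old outer path. Arcs of the first stretch start in the old core, arcs of the second were
          forward before.\<close>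
        let ?l = "(s # rev p2) @ \<eta>v u # k'"
        have "path_graph ?l = graph_union (path_graph (rev (p @ [s]))) (path_graph k)"
          using path_graph_append[of "s # rev p2" "\<eta>v u" k'] p2 k' by simp
        then have "path_graph ?l = path_graph r" unfolding path_graph_rev using \<eta>'(6) r k 2 d by simp
        moreover have "distinct ?l" using int P(2) k p2 k' by auto
        ultimately have "?l = r" using r 2 \<eta>' by (intro path_graph_unique) auto
        then have "consecutive ((s # rev p2) @ [\<eta>v u]) x y \<or> consecutive k x y"
          using consecutive_appendD[of "s # rev p2" "\<eta>v u" k' x y] r k' by auto
        then show ?thesis
        proof
          assume "consecutive ((s # rev p2) @ [\<eta>v u]) x y"
          then have "x \<in> set (p @ s # q)" using consecutive_mem p2 by fastforce
          then have "x \<in> verts (\<eta>e {u, a})" unfolding P(1) path_graph_sel .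
          then show ?thesis using uaC(1) unfolding core_def by blast
        next
          assume "consecutive k x y"
          then show ?thesis unfolding forward_def using uC w0 k by blast
        qed
      next
        case 3
        have "c' \<in> verts G" using r CG by auto
        moreover have "c \<notin> {c', d'}" "u \<notin> {c', d'}" using 3 r c uC by auto
        ultimately have "forward \<eta>v \<eta>e G C x y" using r \<eta>' 3 unfolding forward_def by metis
        then show ?thesis ..
      qed
    qed
    moreover have "\<forall>w \<in> verts G - verts C. \<eta>v' w = \<eta>v w" using \<eta>' c uC by auto
    moreover have "\<forall>g \<in> edges G. g \<inter> verts C = {} \<longrightarrow> \<eta>e' g = \<eta>e g" using \<eta>' c uC by auto
    ultimately show ?thesis using \<eta>'(1) core by blast
  qed
qed

section \<open>Circuits and small cuts in cubic graphs\<close>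

lemma simple_circuit:
  assumes "circuit C" shows "simple_graph C"
proof -
  obtain p where p: "3 \<le> length p" "distinct p" "C = UGraph (set p) (insert {last p, hd p} (path_edges p))"
    using assms by (auto simp: circuit_def)
  obtain a b r where "p = a # b # r" using p(1) by (cases p; cases "tl p") auto
  then have "last p \<noteq> hd p" "last p \<in> set p" "hd p \<in> set p" using p by auto
  then show ?thesis using p by (auto simp: simple_graph_def dest: path_edges_subset path_edges_card)
qed

lemma circuit_ofI:
  assumes "simple_graph G" "3 \<le> length p" "distinct p" "set p \<subseteq> verts G" "path_edges p \<subseteq> edges G"
    "{last p, hd p} \<in> edges G"
  shows "circuit_of (UGraph (set p) (insert {last p, hd p} (path_edges p))) G"
proof -
  have "circuit (UGraph (set p) (insert {last p, hd p} (path_edges p)))"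
    using assms unfolding circuit_def by blast
  then show ?thesis using assms simple_circuit by (auto simp: circuit_of_def subgraph_def)
qed

text \<open>Take a longest path. All neighbours of its first vertex lie on it, and by the degree one
  of them is not the second vertex; the edge to that neighbour closes a circuit.\<close>

lemma min_degree_circuit:
  assumes G: "simple_graph G" and ne: "verts G \<noteq> {}" and deg: "\<And>v. v \<in> verts G \<Longrightarrow> 2 \<le> degree G v"
  shows "\<exists>C. circuit_of C G"
proof -
  define P where "P p \<longleftrightarrow> distinct p \<and> p \<noteq> [] \<and> set p \<subseteq> verts G \<and> path_edges p \<subseteq> edges G" for p
  have fin: "finite (verts G)" using G by (simp add: simple_graph_def)
  obtain v where "v \<in> verts G" using ne by auto
  then have "P [v]" by (simp add: P_def)
  moreover have "\<forall>p. P p \<longrightarrow> length p < Suc (card (verts G))"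
    using fin by (auto simp: P_def less_Suc_eq_le distinct_card[symmetric] intro: card_mono)
  ultimately obtain p where p: "P p" and max: "\<And>q. P q \<Longrightarrow> length q \<le> length p"
    using ex_has_greatest_nat[of P "[v]" length "Suc (card (verts G))"] by blast
  obtain a r where ar: "p = a # r" using p by (cases p) (auto simp: P_def)
  have a: "a \<in> verts G" using p ar by (auto simp: P_def)
  have in_p: "b \<in> set p" if "{a, b} \<in> edges G" for b
  proof (rule ccontr)
    assume "b \<notin> set p"
    then have "P (b # p)" using p that edge_subset[OF G that] ar by (auto simp: P_def insert_commute)
    then show False using max[of "b # p"] by simp
  qed
  let ?S = "{e \<in> edges G. a \<in> e}"
  have S2: "2 \<le> card ?S" using deg[OF a] by (simp add: degree_def)
  have "\<exists>b. {a, b} \<in> edges G \<and> (r \<noteq> [] \<longrightarrow> b \<noteq> hd r)"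
  proof (rule ccontr)
    assume n: "\<not> ?thesis"
    have "?S \<subseteq> {{a, hd r}}"
    proof
      fix e assume e: "e \<in> ?S"
      then obtain x y where "e = {x, y}" using edge_doubleton[OF G] by blast
      then obtain b where "e = {a, b}" using e by (auto simp: insert_commute)
      then show "e \<in> {{a, hd r}}" using n e by auto
    qed
    then have "card ?S \<le> 1" using card_mono[of "{{a, hd r}}" ?S] by simp
    then show False using S2 by simp
  qed
  then obtain b where b: "{a, b} \<in> edges G" "r \<noteq> [] \<longrightarrow> b \<noteq> hd r" by blast
  have "a \<noteq> b" using edge_card[OF G b(1)] by auto
  then have "b \<in> set r" using in_p[OF b(1)] ar by auto
  then obtain xs ys where xs: "r = xs @ b # ys" by (meson split_list)
  have "xs \<noteq> []" using b xs by auto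
  let ?q = "a # xs @ [b]"
  have "path_edges p = path_edges ?q \<union> path_edges (b # ys)"
    using path_edges_append[of "a # xs" b ys] ar xs by simp
  then have "path_edges ?q \<subseteq> edges G" using p by (auto simp: P_def)
  moreover have "distinct ?q" "set ?q \<subseteq> verts G" using p ar xs by (auto simp: P_def)
  moreover have "3 \<le> length ?q" using \<open>xs \<noteq> []\<close> by (cases xs) auto
  moreover have "{last ?q, hd ?q} \<in> edges G" using b by (simp add: insert_commute)
  ultimately show ?thesis using circuit_ofI[OF G, of ?q] by blast
qed

lemma finite_edges: "simple_graph G \<Longrightarrow> finite (edges G)"
  by (rule finite_subset[of _ "Pow (verts G)"]) (auto simp: simple_graph_def)

lemma subgraph_circuit: "circuit_of C G \<Longrightarrow> subgraph G H \<Longrightarrow> circuit_of C H"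
  by (auto simp: circuit_of_def subgraph_def)

text \<open>Deleting a vertex of degree at most one loses one vertex and at most one edge, so the
  inequality persists until the minimum degree is two. The graph does not vanish on the way, since a
  single vertex carries no edge.\<close>

lemma many_edges_circuit:
  assumes "simple_graph G" "verts G \<noteq> {}" "card (verts G) \<le> card (edges G)"
  shows "\<exists>C. circuit_of C G"
  using assms
proof (induction "card (verts G)" arbitrary: G rule: less_induct)
  case less
  note G = less.prems(1)
  have fin: "finite (verts G)" using G by (simp add: simple_graph_def)
  show ?case
  proof (cases "\<forall>v \<in> verts G. 2 \<le> degree G v")
    case True then show ?thesis using min_degree_circuit[OF G less.prems(2)] by blast
  next
    case False
    then obtain v where v: "v \<in> verts G" "card {e \<in> edges G. v \<in> e} \<le> 1" by (auto simp: degree_def)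
    let ?K = "UGraph (verts G - {v}) (edges G - {e \<in> edges G. v \<in> e})"
    have K: "simple_graph ?K" using G by (auto simp: simple_graph_def)
    have E: "card (edges G) - 1 \<le> card (edges ?K)"
      using v(2) diff_card_le_card_Diff[of "{e \<in> edges G. v \<in> e}" "edges G"] finite_edges[OF G] by simp
    have V: "card (verts ?K) = card (verts G) - 1" "0 < card (verts G)" using v fin card_gt_0_iff by auto
    have "verts G \<noteq> {v}"
    proof
      assume "verts G = {v}"
      then have "card e \<le> 1" if "e \<in> edges G" for e
        using edge_subset[OF G that] card_mono[of "{v}" e] by simp
      then have "edges G = {}" using edge_card[OF G] by fastforce
      then show False using less.prems v fin by auto
    qed
    then have "verts ?K \<noteq> {}" using v by auto
    moreover have "card (verts ?K) < card (verts G)" using V by simp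
    moreover have "card (verts ?K) \<le> card (edges ?K)" using V E less.prems by simp
    ultimately obtain C where "circuit_of C ?K" using less.hyps[OF _ K] by blast
    moreover have "subgraph ?K G" using K G by (auto simp: subgraph_def)
    ultimately show ?thesis using subgraph_circuit by blast
  qed
qed

section \<open>Degree counting across a vertex set\<close>

text \<open>Both sides are the sum of the degrees over \<open>X\<close>: an edge inside
  \<open>X\<close> is counted twice, an edge of the cut once.\<close>

lemma cubic_cut_count:
  assumes "cubic H" "X \<subseteq> verts H"
  shows "3 * card X = 2 * card {e \<in> edges H. e \<subseteq> X} + card (edge_cut H X)"
proof -
  have H: "simple_graph H" using assms by (simp add: cubic_def)
  have fX: "finite X" using assms H finite_subset by (auto simp: simple_graph_def)
  note fE = finite_edges[OF H]
  have "3 * card X = (\<Sum>v\<in>X. card {e \<in> edges H. v \<in> e})"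
    using assms by (simp add: cubic_def degree_def subset_iff)
  also have "\<dots> = (\<Sum>v\<in>X. \<Sum>e\<in>edges H. if v \<in> e then 1 else 0)"
    using fE by (simp add: sum.If_cases Int_def)
  also have "\<dots> = (\<Sum>e\<in>edges H. \<Sum>v\<in>X. if v \<in> e then 1 else 0)" by (rule sum.swap)
  also have "\<dots> = (\<Sum>e\<in>edges H. card (e \<inter> X))"
    using fX by (simp add: sum.If_cases Int_def conj_commute)
  also have "\<dots> = (\<Sum>e\<in>edges H. 2 * (if e \<subseteq> X then 1 else 0) + (if card (e \<inter> X) = 1 then 1 else 0))"
  proof (rule sum.cong[OF refl])
    fix e assume "e \<in> edges H"
    then obtain a b where "e = {a, b}" "a \<noteq> b" using edge_doubleton[OF H] by blast
    then show "card (e \<inter> X) = 2 * (if e \<subseteq> X then 1 else 0) + (if card (e \<inter> X) = 1 then 1 else 0)"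
      by (cases "a \<in> X"; cases "b \<in> X") auto
  qed
  also have "\<dots> = 2 * card {e \<in> edges H. e \<subseteq> X} + card (edge_cut H X)"
    using fE by (simp add: sum.distrib sum.If_cases sum_distrib_left[symmetric] edge_cut_def Int_def)
  finally show ?thesis .
qed

text \<open>With \<open>m\<close> edges inside \<open>X\<close>, the count gives
  \<open>2m >= 3|X| - 4 >= 2|X|\<close>; the last inequality is where \<open>|X| >= 4\<close>
  enters. So \<open>X\<close> induces at least as many edges as vertices.\<close>

lemma small_cut_circuit:
  assumes "cubic H" "X \<subseteq> verts H" "4 \<le> card X" "card (edge_cut H X) \<le> 4"
  shows "\<exists>C. circuit_of C H \<and> verts C \<subseteq> X"
proof -
  have H: "simple_graph H" using assms by (simp add: cubic_def)
  let ?K = "UGraph X {e \<in> edges H. e \<subseteq> X}"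
  have "finite X" using assms(3) card.infinite by fastforce
  then have K: "simple_graph ?K" using H by (auto simp: simple_graph_def)
  have "card (verts ?K) \<le> card (edges ?K)" using cubic_cut_count[OF assms(1,2)] assms(3,4) by simp
  moreover have "verts ?K \<noteq> {}" using assms(3) by auto
  ultimately obtain C where C: "circuit_of C ?K" using many_edges_circuit[OF K] by blast
  moreover have "subgraph ?K H" using K H assms by (auto simp: subgraph_def)
  ultimately show ?thesis using subgraph_circuit by (fastforce simp: circuit_of_def subgraph_def)
qed

lemma edge_cut_complement:
  assumes "simple_graph H"
  shows "edge_cut H (verts H - X) = edge_cut H X"
proof -
  have "card (e \<inter> (verts H - X)) = 1 \<longleftrightarrow> card (e \<inter> X) = 1" if e: "e \<in> edges H" for e
  proof -
    obtain a b where "e = {a, b}" "a \<noteq> b" "a \<in> verts H" "b \<in> verts H" using edge_doubleton[OF assms e] by blast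
    then show ?thesis by (cases "a \<in> X"; cases "b \<in> X") (auto simp: Int_insert_left)
  qed
  then show ?thesis by (auto simp: edge_cut_def)
qed

lemma five_connected_cut:
  assumes "cubic H" "cyclically_connected 5 H" "X \<subseteq> verts H" "4 \<le> card X" "4 \<le> card (verts H - X)"
  shows "5 \<le> card (edge_cut H X)"
proof (rule ccontr)
  assume "\<not> ?thesis"
  then have c: "card (edge_cut H X) \<le> 4" by simp
  have "simple_graph H" using assms by (simp add: cubic_def)
  then have "card (edge_cut H (verts H - X)) \<le> 4" using c edge_cut_complement by metis
  then have "\<exists>C. circuit_of C H \<and> verts C \<subseteq> verts H - X" using assms by (intro small_cut_circuit) auto
  moreover have "\<exists>C. circuit_of C H \<and> verts C \<subseteq> X" using assms c by (intro small_cut_circuit) auto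
  ultimately have "5 \<le> card (edge_cut H X)" using assms unfolding cyclically_connected_def by blast
  then show False using c by simp
qed

section \<open>Circuits of length four, and branch vertices in cubic graphs\<close>

lemma path_edges_count: "distinct p \<Longrightarrow> card (path_edges p) = length p - 1"
proof (induction p)
  case (Cons x p)
  show ?case
  proof (cases p)
    case (Cons y r)
    have "{x, y} \<notin> path_edges p" using path_edges_subset[of "{x, y}" p] Cons.prems by auto
    then show ?thesis using Cons.IH Cons.prems Cons finite_path_edges[of p] by simp
  qed simp
qed simp

lemma circuit_four:
  assumes "circuit C" "circuit_length C = 4"
  obtains a b c d where "distinct [a, b, c, d]" "verts C = {a, b, c, d}" "edges C = {{a, b}, {b, c}, {c, d}, {d, a}}"
proof -
  obtain p where p: "3 \<le> length p" "distinct p" "C = UGraph (set p) (insert {last p, hd p} (path_edges p))"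
    using assms by (auto simp: circuit_def)
  obtain x y z r where r: "p = x # y # z # r" using p(1) by (cases p; cases "tl p"; cases "tl (tl p)") auto
  \<comment> \<open>The closing edge is new because the list has at least three vertices; so the
    circuit has as many edges as vertices, and the length fixes the list.\<close>
  have "{last p, hd p} \<notin> path_edges p"
  proof
    assume "{last p, hd p} \<in> path_edges p"
    moreover have "{last p, hd p} \<noteq> {x, y}" using r p(2) by (auto simp: doubleton_eq_iff)
    ultimately have "{last p, hd p} \<in> path_edges (y # z # r)" using r by simp
    then show False using path_edges_subset r p(2) by fastforce
  qed
  then have "card (edges C) = length p" using p path_edges_count[OF p(2)] finite_path_edges[of p] by simp
  then have "length r = 1" using assms(2) r by (simp add: circuit_length_def)
  then obtain w where "r = [w]" by (auto simp: length_Suc_conv)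
  then show ?thesis using that[of x y z w] p r by (auto simp: insert_commute)
qed

lemma girth_no_triangle:
  assumes "simple_graph G" "4 \<le> girth G" "{a, b} \<in> edges G" "{b, c} \<in> edges G"
  shows "{a, c} \<notin> edges G"
proof
  assume ac: "{a, c} \<in> edges G"
  let ?p = "[a, b, c]"
  let ?C = "UGraph (set ?p) (insert {last ?p, hd ?p} (path_edges ?p))"
  have "a \<noteq> b" "b \<noteq> c" "a \<noteq> c" using assms edge_card[OF assms(1) ac] edge_card[OF assms(1,3)] edge_card[OF assms(1,4)] by auto
  then have "circuit_of ?C G"
    using assms ac edge_subset[OF assms(1,3)] edge_subset[OF assms(1,4)]
    by (intro circuit_ofI) (auto simp: insert_commute)
  then have "girth G \<le> enat (circuit_length ?C)" unfolding girth_def by (intro INF_lower) simp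
  moreover have "circuit_length ?C \<le> 3" by (simp add: circuit_length_def card_insert_le_m1)
  ultimately have "enat 4 \<le> enat 3"
    using assms(2) by (metis dual_order.trans enat_ord_simps(1) numeral_eq_enat)
  then show False by simp
qed

lemma cubic_third_neighbour:
  assumes "cubic G" "{c, a} \<in> edges G" "{c, b} \<in> edges G" "a \<noteq> b"
  obtains d where "distinct [a, b, d]" "c \<noteq> d" "{c, d} \<in> edges G"
    "\<And>e. e \<in> edges G \<Longrightarrow> c \<in> e \<Longrightarrow> e \<in> {{c, a}, {c, b}, {c, d}}"
proof -
  have G: "simple_graph G" using assms by (simp add: cubic_def)
  let ?S = "{e \<in> edges G. c \<in> e}"
  have c: "c \<in> verts G" using edge_subset[OF G assms(2)] by auto
  have S: "card ?S = 3" using assms(1) c by (simp add: cubic_def degree_def)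
  have ne: "{c, a} \<noteq> {c, b}" using assms(4) by (auto simp: doubleton_eq_iff)
  have "card (?S - {{c, a}, {c, b}}) = 1"
    using S ne assms by (subst card_Diff_subset) auto
  then obtain e where e: "?S - {{c, a}, {c, b}} = {e}" by (auto simp: card_1_singleton_iff)
  then have eS: "e \<in> edges G" "c \<in> e" "e \<noteq> {c, a}" "e \<noteq> {c, b}" by auto
  obtain x y where "e = {x, y}" "x \<noteq> y" using edge_doubleton[OF G eS(1)] by blast
  then obtain d where d: "e = {c, d}" "c \<noteq> d" using eS(2) by (auto simp: insert_commute)
  show ?thesis
  proof (rule that[of d])
    show "distinct [a, b, d]" using assms d eS by auto
    show "c \<noteq> d" "{c, d} \<in> edges G" using d eS by auto
    show "e' \<in> {{c, a}, {c, b}, {c, d}}" if "e' \<in> edges G" "c \<in> e'" for e' using e d that by blast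
  qed
qed

text \<open>The images of the three edges at \<open>v\<close> are edge-disjoint and each contains an
  edge at \<open>\<eta>v v\<close>. This makes three different edges there, and \<open>H\<close> has
  no more. So no edge outside the image of \<open>G\<close> ends at a branch vertex.\<close>

lemma branch_edge:
  assumes \<eta>: "homeo_embedding \<eta>v \<eta>e G H" and G: "cubic G" and H: "cubic H"
    and v: "v \<in> verts G" and e: "e \<in> edges H" "\<eta>v v \<in> e"
  shows "\<exists>g \<in> edges G. v \<in> g \<and> e \<in> edges (\<eta>e g)"
proof -
  have sG: "simple_graph G" and sH: "simple_graph H" using G H by (auto simp: cubic_def)
  let ?S = "{g \<in> edges G. v \<in> g}" and ?T = "{e \<in> edges H. \<eta>v v \<in> e}"
  have vH: "\<eta>v v \<in> verts H" using homeo_embedding_verts[OF \<eta>] v by auto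
  have card: "card ?S = 3" "card ?T = 3" using G H v vH by (auto simp: cubic_def degree_def)
  have "\<exists>h. h \<in> edges (\<eta>e g) \<and> \<eta>v v \<in> h" if g: "g \<in> ?S" for g
  proof -
    obtain a b where ab: "g = {a, b}" "a \<noteq> b" "a \<in> verts G" "b \<in> verts G"
      using edge_doubleton[OF sG] g by blast
    then have "is_path (\<eta>e g) (\<eta>v a) (\<eta>v b)" using homeo_embedding_path[OF \<eta>, of a b] g by auto
    then obtain p where p: "p \<noteq> []" "hd p = \<eta>v a" "last p = \<eta>v b" "\<eta>e g = path_graph p" by (rule is_pathE)
    have "\<eta>v a \<noteq> \<eta>v b" using ab homeo_embedding_inj[OF \<eta>] by (auto dest: inj_onD)
    then have "2 \<le> length p" using p by (cases p; cases "tl p") auto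
    moreover have "\<eta>v v \<in> set p" using homeo_embedding_incident[OF \<eta> v, of g] g p by simp
    ultimately show ?thesis using path_vertex_in_edge[of p "\<eta>v v"] p by auto
  qed
  then obtain f where f: "\<And>g. g \<in> ?S \<Longrightarrow> f g \<in> edges (\<eta>e g) \<and> \<eta>v v \<in> f g" by metis
  have "inj_on f ?S"
  proof (rule inj_onI, rule ccontr)
    fix g g' assume g: "g \<in> ?S" "g' \<in> ?S" "f g = f g'" "g \<noteq> g'"
    then show False using f[OF g(1)] f[OF g(2)] homeo_embedding_edge_disjoint[OF \<eta>, of g g'] by auto
  qed
  moreover have "f ` ?S \<subseteq> ?T"
  proof
    fix h assume "h \<in> f ` ?S"
    then obtain g where g: "g \<in> ?S" "h = f g" by auto
    then show "h \<in> ?T" using f[OF g(1)] homeo_embedding_subgraph[OF \<eta> sG, of g] by (auto simp: subgraph_def)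
  qed
  moreover have "finite ?T" using finite_edges[OF sH] by simp
  ultimately have "f ` ?S = ?T" using card by (intro card_seteq) (auto simp: card_image)
  then obtain g where "g \<in> ?S" "e = f g" using e by auto
  then show ?thesis using f by auto
qed

lemma quadrangle_neighbours:
  assumes G: "cubic G" and g: "4 \<le> girth G"
    and E: "{a, b} \<in> edges G" "{b, c} \<in> edges G" "{c, d} \<in> edges G" "{d, a} \<in> edges G"
    and dist: "distinct [a, b, c, d]"
  shows "\<exists>e. e \<notin> {a, b, c, d} \<and> {a, e} \<in> edges G \<and>
    (\<forall>h \<in> edges G. a \<in> h \<longrightarrow> h \<in> {{a, b}, {a, d}, {a, e}})"
proof -
  have "{a, d} \<in> edges G" "b \<noteq> d" using E(4) dist by (auto simp: insert_commute)
  then obtain e where e: "distinct [b, d, e]" "a \<noteq> e" "{a, e} \<in> edges G"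
    "\<And>h. h \<in> edges G \<Longrightarrow> a \<in> h \<Longrightarrow> h \<in> {{a, b}, {a, d}, {a, e}}"
    using cubic_third_neighbour[OF G E(1)] by metis
  \<comment> \<open>A chord \<open>ac\<close> would close the triangle \<open>abc\<close>.\<close>
  have "e \<noteq> c" using girth_no_triangle[OF _ g E(1,2)] G e(3) by (auto simp: cubic_def)
  then show ?thesis using e by (intro exI[of _ e]) auto
qed

lemma circuit_four_quadrangle:
  fixes G :: "'a::infinite ugraph"
  assumes G: "cubic G" and g: "4 \<le> girth G" and C: "circuit_of C G" "circuit_length C = 4"
  shows "quadrangle G C" "card (verts C) = 4"
proof -
  have CG: "verts C \<subseteq> verts G" "edges C \<subseteq> edges G" using C by (auto simp: circuit_of_def subgraph_def)
  obtain a b c d where abcd: "distinct [a, b, c, d]" "verts C = {a, b, c, d}"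
      "edges C = {{a, b}, {b, c}, {c, d}, {d, a}}"
    using circuit_four[OF _ C(2)] C(1) unfolding circuit_of_def by blast
  show "card (verts C) = 4" using abcd by simp
  have E: "{a, b} \<in> edges G" "{b, c} \<in> edges G" "{c, d} \<in> edges G" "{d, a} \<in> edges G"
    using CG abcd by auto
  have step: "\<exists>a b d. distinct [a, b, d] \<and> a \<in> verts C \<and> b \<in> verts C \<and> d \<notin> verts C \<and>
      {x, a} \<in> edges C \<and> {x, b} \<in> edges C \<and> {x, d} \<in> edges G \<and>
      (\<forall>e \<in> edges G. x \<in> e \<longrightarrow> e \<in> {{x, a}, {x, b}, {x, d}})"
    if x: "distinct [x, y, z, w]" "{x, y, z, w} = verts C" "{{x, y}, {y, z}, {z, w}, {w, x}} = edges C" for x y z w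
  proof -
    have "{x, y} \<in> edges G" "{y, z} \<in> edges G" "{z, w} \<in> edges G" "{w, x} \<in> edges G"
      using x(3) CG(2) by auto
    then obtain e where e: "e \<notin> {x, y, z, w}" "{x, e} \<in> edges G"
        "\<forall>h \<in> edges G. x \<in> h \<longrightarrow> h \<in> {{x, y}, {x, w}, {x, e}}"
      using quadrangle_neighbours[OF G g _ _ _ _ x(1)] by blast
    have "{x, w} \<in> edges C" using x(3) by (auto simp: insert_commute)
    moreover have "{x, y} \<in> edges C" using x(3) by auto
    moreover have "y \<in> verts C" "w \<in> verts C" "e \<notin> verts C" using x(2) e(1) by auto
    moreover have "distinct [y, w, e]" using x(1) e(1) by auto
    ultimately show ?thesis using e(2,3) by blast
  qed
  show "quadrangle G C"
  proof
    show "simple_graph G" using G by (simp add: cubic_def)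
    show "verts C \<subseteq> verts G" "edges C \<subseteq> edges G" by fact+
    show "e \<subseteq> verts C" if "e \<in> edges C" for e using that abcd by auto
    show "\<exists>a b d. distinct [a, b, d] \<and> a \<in> verts C \<and> b \<in> verts C \<and> d \<notin> verts C \<and>
      {v, a} \<in> edges C \<and> {v, b} \<in> edges C \<and> {v, d} \<in> edges G \<and>
      (\<forall>e \<in> edges G. v \<in> e \<longrightarrow> e \<in> {{v, a}, {v, b}, {v, d}})" if v: "v \<in> verts C" for v
    proof -
      consider "v = a" | "v = b" | "v = c" | "v = d" using v abcd(2) by auto
      then show ?thesis
      proof cases
        case 1 show ?thesis unfolding 1 by (rule step[of a b c d]) (use abcd in auto)
      next
        case 2 show ?thesis unfolding 2 by (rule step[of b c d a]) (use abcd in auto)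
      next
        case 3 show ?thesis unfolding 3 by (rule step[of c d a b]) (use abcd in auto)
      next
        case 4 show ?thesis unfolding 4 by (rule step[of d a b c]) (use abcd in auto)
      qed
    qed
    show "\<exists>u a. e = {u, a} \<and> {v, u} \<in> edges C" if e: "e \<in> edges C" "v \<in> verts C" "v \<notin> e" for e v
    proof -
      have r: ?thesis if "e = {x, y}" "{v, x} \<in> edges C \<or> {v, y} \<in> edges C" for x y
        using that by (metis insert_commute)
      have "v = a \<or> v = b \<or> v = c \<or> v = d" using e(2) abcd(2) by auto
      moreover have "e = {a, b} \<or> e = {b, c} \<or> e = {c, d} \<or> e = {d, a}" using e(1) abcd(3) by auto
      moreover have "{a, b} \<in> edges C" "{b, a} \<in> edges C" "{b, c} \<in> edges C" "{c, b} \<in> edges C"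
          "{c, d} \<in> edges C" "{d, c} \<in> edges C" "{d, a} \<in> edges C" "{a, d} \<in> edges C"
        using abcd(3) by (auto simp: insert_commute)
      ultimately show ?thesis using e(3)
        by (elim disjE) ((simp; fail) | (rule r, assumption, simp))+
    qed
  qed
qed

text \<open>The extended embedding changes values only at \<open>x\<close>, \<open>y\<close> and at
  edges containing them. These vertices lie outside \<open>G\<close>, so nothing in \<open>F\<close>
  is affected.\<close>

lemma F_contains_plus_edge:
  assumes \<eta>: "homeo_embedding \<eta>v \<eta>e G H" "fixes_subgraph \<eta>v \<eta>e F"
    and G: "simple_graph (G :: 'a::infinite ugraph)" and H: "simple_graph H" and FG: "subgraph F G"
    and e: "e \<in> edges G" "e \<notin> edges F" "s \<in> verts (\<eta>e e)" "s \<notin> \<eta>v ` verts G"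
    and f: "f \<in> edges G" "f \<notin> edges F" "t \<in> verts (\<eta>e f)" "t \<notin> \<eta>v ` verts G"
    and ef: "e \<noteq> f"
    and Q: "distinct Q" "Q \<noteq> []" "hd Q = s" "last Q = t" "set Q \<subseteq> verts H" "path_edges Q \<subseteq> edges H"
      "set Q \<inter> embedded_verts \<eta>v \<eta>e G \<subseteq> {s, t}"
  shows "\<exists>x y. x \<notin> verts G \<and> y \<notin> verts G \<and> x \<noteq> y \<and> simple_graph (plus_edge G e f x y) \<and>
    F_contains F H (plus_edge G e f x y)"
proof -
  obtain a b where ab: "e = {a, b}" "a \<in> verts G" "b \<in> verts G" using edge_doubleton[OF G e(1)] by metis
  obtain c d where cd: "f = {c, d}" "c \<in> verts G" "d \<in> verts G" using edge_doubleton[OF G f(1)] by metis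
  have br: "s \<noteq> \<eta>v a" "s \<noteq> \<eta>v b" "t \<noteq> \<eta>v c" "t \<noteq> \<eta>v d" using e f ab cd by auto
  obtain p q where P: "\<eta>e {a, b} = path_graph (p @ s # q)" "distinct (p @ s # q)" "p \<noteq> []" "q \<noteq> []"
      "hd p = \<eta>v a" "last q = \<eta>v b"
    using split_interior[OF \<eta>(1) e(1)[unfolded ab(1)] e(3)[unfolded ab(1)] br(1,2)] by metis
  obtain p' q' where P': "\<eta>e {c, d} = path_graph (p' @ t # q')" "distinct (p' @ t # q')" "p' \<noteq> []" "q' \<noteq> []"
      "hd p' = \<eta>v c" "last q' = \<eta>v d"
    using split_interior[OF \<eta>(1) f(1)[unfolded cd(1)] f(3)[unfolded cd(1)] br(3,4)] by metis
  have "finite (verts G)" using G by (simp add: simple_graph_def)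
  then obtain x where x: "x \<notin> verts G" using ex_new_if_finite infinite_UNIV by blast
  then obtain y where y: "y \<notin> verts G" "x \<noteq> y"
    using ex_new_if_finite[of "insert x (verts G)"] infinite_UNIV \<open>finite (verts G)\<close> by auto
  note xy = x y
  note E = e(1)[unfolded ab(1)] f(1)[unfolded cd(1)] ef[unfolded ab(1) cd(1)]
  let ?v = "\<eta>v(x := s, y := t)"
  let ?e = "\<eta>e({x, a} := path_graph (p @ [s]), {x, b} := path_graph (s # q),
        {y, c} := path_graph (p' @ [t]), {y, d} := path_graph (t # q'), {x, y} := path_graph Q)"
  have h: "homeo_embedding ?v ?e (plus_edge G e f x y) H"
    unfolding ab(1) cd(1) by (rule plus_edge_embedding[OF \<eta>(1) G H E xy P P' Q])
  have "fixes_subgraph ?v ?e F"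
    unfolding fixes_subgraph_def
  proof (intro conjI ballI)
    fix g assume g: "g \<in> edges F"
    then have "g \<in> edges G" using FG by (auto simp: subgraph_def)
    then have "x \<notin> g" "y \<notin> g" using edge_subset[OF G] xy by auto
    then have "?e g = \<eta>e g" by auto
    then show "?e g = UGraph g {g}" using \<eta>(2) g by (simp add: fixes_subgraph_def)
  next
    fix v assume v: "v \<in> verts F"
    then have "v \<noteq> x" "v \<noteq> y" using FG xy by (auto simp: subgraph_def)
    then show "?v v = v" using \<eta>(2) v by (simp add: fixes_subgraph_def)
  qed
  moreover have "simple_graph (plus_edge G e f x y)"
    unfolding ab(1) cd(1) by (rule simple_plus_edge[OF G E xy])
  ultimately show ?thesis using h xy unfolding F_contains_def by blast
qed

section \<open>Augmenting walks\<close>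

context quadrangle
begin

text \<open>A walk from \<open>core\<close> to \<open>rim\<close> in the residual digraph is an augmenting path for the four
  paths \<open>\<eta>({c, d})\<close>, with \<open>c\<close> in \<open>C\<close> and \<open>d\<close> not. Since \<open>H\<close> is cubic, edge-disjoint paths
  are vertex-disjoint, so the vertices need not be split.\<close>

definition residual ::
    "('a \<Rightarrow> 'b) \<Rightarrow> ('a set \<Rightarrow> 'b ugraph) \<Rightarrow> 'b ugraph \<Rightarrow> 'b \<Rightarrow> 'b \<Rightarrow> bool" where
  "residual \<eta>v \<eta>e H v w \<longleftrightarrow> {v, w} \<in> edges H \<and> \<not> forward \<eta>v \<eta>e G C v w"

definition rim :: "('a \<Rightarrow> 'b) \<Rightarrow> ('a set \<Rightarrow> 'b ugraph) \<Rightarrow> 'b set" where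
  "rim \<eta>v \<eta>e = \<eta>v ` (verts G - verts C) \<union> (\<Union>g\<in>{g \<in> edges G. g \<inter> verts C = {}}. verts (\<eta>e g))"

definition walk :: "('a \<Rightarrow> 'b) \<Rightarrow> ('a set \<Rightarrow> 'b ugraph) \<Rightarrow> 'b ugraph \<Rightarrow> 'b list \<Rightarrow> bool" where
  "walk \<eta>v \<eta>e H ws \<longleftrightarrow> ws \<noteq> [] \<and> successively (residual \<eta>v \<eta>e H) ws \<and> hd ws \<in> core \<eta>e \<and> last ws \<in> rim \<eta>v \<eta>e"

text \<open>Edge-disjointness puts the edge on a single outer path, and the start of that path
  determines its list. So the direction in which an arc is forward can be read off any such list,
  and no arc is forward both ways.\<close>

lemma forward_path_unique:
  assumes \<eta>: "homeo_embedding \<eta>v \<eta>e G H"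
    and c: "c \<in> verts C" "d \<notin> verts C" "{c, d} \<in> edges G" "\<eta>e {c, d} = path_graph p" "distinct p" "p \<noteq> []" "hd p = \<eta>v c"
    and f: "forward \<eta>v \<eta>e G C v w" "{v, w} \<in> path_edges p"
  shows "consecutive p v w"
proof -
  obtain c' d' p' where c': "c' \<in> verts C" "d' \<notin> verts C" "{c', d'} \<in> edges G" "\<eta>e {c', d'} = path_graph p'"
      "distinct p'" "p' \<noteq> []" "hd p' = \<eta>v c'" "consecutive p' v w"
    using f(1) unfolding forward_def by blast
  have "{v, w} \<in> edges (\<eta>e {c, d}) \<inter> edges (\<eta>e {c', d'})" using consecutive_mem[OF c'(8)] f(2) c c' by simp
  then have "{c, d} = {c', d'}" using homeo_embedding_edge_disjoint[OF \<eta> c(3) c'(3)] by auto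
  then have "c' = c" "d' = d" using c c' by (auto simp: doubleton_eq_iff)
  then have "p' = p" using c c' by (intro path_graph_unique) auto
  then show ?thesis using c' by simp
qed

text \<open>The cut side of the max-flow min-cut argument. An edge leaving a closed set is a forward
  arc, and since reversed forward arcs are residual, the set meets each outer path in an initial
  segment. So every path contributes at most one edge, and there is one path for each vertex of
  \<open>C\<close>.\<close>

lemma cut_closed_le_4:
  assumes \<eta>: "homeo_embedding \<eta>v \<eta>e G H" and H: "simple_graph H"
    and card: "card (verts C) = 4" and X: "\<And>v w. v \<in> X \<Longrightarrow> residual \<eta>v \<eta>e H v w \<Longrightarrow> w \<in> X"
  shows "card (edge_cut H X) \<le> 4"
proof -
  define A where "A c = {{v, w} | v w. v \<in> X \<and> w \<notin> X \<and> (\<exists>d p. d \<notin> verts C \<and> {c, d} \<in> edges G \<and>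
      \<eta>e {c, d} = path_graph p \<and> distinct p \<and> p \<noteq> [] \<and> hd p = \<eta>v c \<and> consecutive p v w)}" for c
  have "edge_cut H X \<subseteq> (\<Union>c\<in>verts C. A c)"
  proof
    fix e assume "e \<in> edge_cut H X"
    then have e: "e \<in> edges H" "card (e \<inter> X) = 1" by (auto simp: edge_cut_def)
    obtain a b where ab: "e = {a, b}" "a \<noteq> b" using edge_doubleton[OF H e(1)] by metis
    then have "\<exists>v w. e = {v, w} \<and> v \<in> X \<and> w \<notin> X"
      using e(2) by (cases "a \<in> X"; cases "b \<in> X") (auto simp: Int_insert_left)
    then obtain v w where vw: "e = {v, w}" "v \<in> X" "w \<notin> X" by blast
    then have "forward \<eta>v \<eta>e G C v w" using X[of v w] e by (auto simp: residual_def)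
    then show "e \<in> (\<Union>c\<in>verts C. A c)" unfolding forward_def A_def using vw by blast
  qed
  moreover have A1: "card (A c) \<le> 1 \<and> finite (A c)" if c: "c \<in> verts C" for c
  proof -
    have "e = e'" if ee: "e \<in> A c" "e' \<in> A c" for e e'
    proof -
      obtain v w d p where 1: "e = {v, w}" "v \<in> X" "w \<notin> X" "d \<notin> verts C" "{c, d} \<in> edges G"
          "\<eta>e {c, d} = path_graph p" "distinct p" "p \<noteq> []" "hd p = \<eta>v c" "consecutive p v w"
        using ee(1) unfolding A_def by blast
      obtain v' w' d' p' where 2: "e' = {v', w'}" "v' \<in> X" "w' \<notin> X" "d' \<notin> verts C" "{c, d'} \<in> edges G"
          "\<eta>e {c, d'} = path_graph p'" "distinct p'" "p' \<noteq> []" "hd p' = \<eta>v c" "consecutive p' v' w'"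
        using ee(2) unfolding A_def by blast
      have "d' = d" using outer_unique[OF c 1(5,4) 2(5,4)] by simp
      then have "p' = p" using 1 2 by (intro path_graph_unique) auto
      \<comment> \<open>In a distinct list no pair is consecutive in both orders, so stepping back
        along the path is residual and stays in \<open>X\<close>.\<close>
      have prev: "p ! k \<in> X" if k: "Suc k < length p" "p ! Suc k \<in> X" for k
      proof -
        have pe: "{p ! Suc k, p ! k} \<in> path_edges p" using k by (auto simp: path_edges_def)
        have "\<not> forward \<eta>v \<eta>e G C (p ! Suc k) (p ! k)"
        proof
          assume "forward \<eta>v \<eta>e G C (p ! Suc k) (p ! k)"
          then have "consecutive p (p ! Suc k) (p ! k)"
            using forward_path_unique[OF \<eta> c 1(4-9) _ pe] by blast
          then show False using k 1(7) by (auto simp: consecutive_def nth_eq_iff_index_eq)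
        qed
        moreover have "{p ! Suc k, p ! k} \<in> edges H"
          using pe homeo_embedding_subgraph[OF \<eta> simple 1(5)] 1(6) by (auto simp: subgraph_def)
        ultimately show ?thesis using X[OF k(2)] by (simp add: residual_def)
      qed
      have prefix: "p ! k \<in> X" if "k \<le> j" "j < length p" "p ! j \<in> X" for k j
        using that
      proof (induction rule: inc_induct)
        case (step n)
        then show ?case using prev[of n] by simp
      qed
      obtain i where i: "Suc i < length p" "v = p ! i" "w = p ! Suc i" using 1(10) by (auto simp: consecutive_def)
      obtain j where j: "Suc j < length p" "v' = p ! j" "w' = p ! Suc j"
        using 2(10) \<open>p' = p\<close> by (auto simp: consecutive_def)
      have "\<not> Suc i \<le> j" using prefix[of "Suc i" j] i j 1 2 by auto
      moreover have "\<not> Suc j \<le> i" using prefix[of "Suc j" i] i j 1 2 by auto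
      ultimately have "i = j" by simp
      then show ?thesis using i j 1 2 by simp
    qed
    then have "A c = {} \<or> (\<exists>e. A c = {e})" by blast
    then show ?thesis by auto
  qed
  moreover have "finite (verts C)" using card card.infinite by fastforce
  ultimately have "card (edge_cut H X) \<le> card (\<Union>c\<in>verts C. A c)"
    by (intro card_mono) auto
  also have "\<dots> \<le> (\<Sum>c\<in>verts C. card (A c))" by (rule card_UN_le) fact
  also have "\<dots> \<le> (\<Sum>c\<in>verts C. 1)" using A1 by (intro sum_mono) auto
  finally show ?thesis using card by simp
qed

lemma core_vertex: "homeo_embedding \<eta>v \<eta>e G H \<Longrightarrow> c \<in> verts C \<Longrightarrow> \<eta>v c \<in> core \<eta>e"
proof -
  assume \<eta>: "homeo_embedding \<eta>v \<eta>e G H" and c: "c \<in> verts C"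
  obtain a where a: "{c, a} \<in> edges C" using nbrs[OF c] by blast
  then have "\<eta>v c \<in> verts (\<eta>e {c, a})"
    using homeo_embedding_incident[OF \<eta>, of c "{c, a}"] c CG by auto
  then show ?thesis using a by (auto simp: core_def)
qed

lemma core_rim_disjoint:
  assumes \<eta>: "homeo_embedding \<eta>v \<eta>e G H"
  shows "core \<eta>e \<inter> rim \<eta>v \<eta>e = {}"
proof -
  have False if z: "z \<in> verts (\<eta>e e)" "e \<in> edges C" "z \<in> rim \<eta>v \<eta>e" for z e
  proof -
    have e: "e \<in> edges G" "e \<subseteq> verts C" using z CG C_edge by auto
    consider w where "w \<in> verts G - verts C" "z = \<eta>v w" | g where "g \<in> edges G" "g \<inter> verts C = {}" "z \<in> verts (\<eta>e g)"
      using z(3) by (auto simp: rim_def)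
    then show False
    proof cases
      case 1 then show False using homeo_embedding_incident[OF \<eta> _ e(1), of w] z e by auto
    next
      case 2
      have "e \<noteq> {}" using edge_card[OF simple e(1)] by auto
      then have "g \<noteq> e" using 2(2) e by blast
      then show False using homeo_embedding_disjoint[OF \<eta> simple 2(1) e(1)] z 2 e by auto
    qed
  qed
  then show ?thesis by (auto simp: core_def)
qed

lemma residual_walk_exists:
  assumes \<eta>: "homeo_embedding \<eta>v \<eta>e G H" and H: "cubic H" "cyclically_connected 5 H"
    and card: "card (verts C) = 4" "8 \<le> card (verts G)"
  shows "\<exists>ws. walk \<eta>v \<eta>e H ws"
proof (rule ccontr)
  assume no: "\<not> ?thesis"
  have sH: "simple_graph H" using H by (simp add: cubic_def)
  define X where "X = {w. \<exists>ws. ws \<noteq> [] \<and> successively (residual \<eta>v \<eta>e H) ws \<and> hd ws \<in> core \<eta>e \<and> last ws = w}"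
  have core: "core \<eta>e \<subseteq> X"
  proof
    fix z assume "z \<in> core \<eta>e" then show "z \<in> X" unfolding X_def by (intro CollectI exI[of _ "[z]"]) simp
  qed
  have closed: "w \<in> X" if "v \<in> X" "residual \<eta>v \<eta>e H v w" for v w
  proof -
    obtain ws where "ws \<noteq> []" "successively (residual \<eta>v \<eta>e H) ws" "hd ws \<in> core \<eta>e" "last ws = v"
      using \<open>v \<in> X\<close> by (auto simp: X_def)
    then have "ws @ [w] \<noteq> [] \<and> successively (residual \<eta>v \<eta>e H) (ws @ [w]) \<and> hd (ws @ [w]) \<in> core \<eta>e \<and> last (ws @ [w]) = w"
      using that(2) by (simp add: successively_append_iff)
    then show ?thesis unfolding X_def by blast
  qed
  have "core \<eta>e \<subseteq> verts H"
    using homeo_embedding_subgraph[OF \<eta> simple] CG by (fastforce simp: core_def subgraph_def)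
  have XH: "X \<subseteq> verts H"
  proof
    fix w assume "w \<in> X"
    then obtain ws where ws: "ws \<noteq> []" "successively (residual \<eta>v \<eta>e H) ws" "hd ws \<in> core \<eta>e" "last ws = w"
      by (auto simp: X_def)
    show "w \<in> verts H"
    proof (cases "butlast ws = []")
      case True
      then have "hd ws = w" using ws by (cases ws) (auto split: if_splits)
      then show ?thesis using ws \<open>core \<eta>e \<subseteq> verts H\<close> by auto
    next
      case False
      have "ws = butlast ws @ [w]" using ws by auto
      then have "successively (residual \<eta>v \<eta>e H) (butlast ws @ [w])" using ws by simp
      then have "{last (butlast ws), w} \<in> edges H"
        using False by (auto simp: successively_append_iff residual_def)
      then show ?thesis using edge_subset[OF sH] by auto
    qed
  qed
  have fH: "finite (verts H)" using sH by (simp add: simple_graph_def)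
  have fG: "finite (verts G)" using simple by (simp add: simple_graph_def)
  have inj: "inj_on \<eta>v (verts G)" by (rule homeo_embedding_inj[OF \<eta>])
  have "\<eta>v ` verts C \<subseteq> X" using core_vertex[OF \<eta>] core by auto
  moreover have "card (\<eta>v ` verts C) = 4" using card inj CG by (metis card_image inj_on_subset)
  ultimately have c1: "4 \<le> card X" using card_mono XH fH by (metis finite_subset)
  have "\<eta>v ` (verts G - verts C) \<subseteq> verts H - X"
  proof
    fix z assume z: "z \<in> \<eta>v ` (verts G - verts C)"
    then have "z \<in> rim \<eta>v \<eta>e" by (simp add: rim_def)
    then have "z \<notin> X" using no unfolding X_def walk_def by blast
    then show "z \<in> verts H - X" using z homeo_embedding_verts[OF \<eta>] by auto
  qed
  moreover have "card (\<eta>v ` (verts G - verts C)) = card (verts G - verts C)"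
    using inj by (intro card_image) (auto intro: inj_on_subset)
  moreover have "card (verts G - verts C) = card (verts G) - 4"
    using card CG fG by (metis card_Diff_subset finite_subset)
  moreover have "finite (verts H - X)" using fH by simp
  ultimately have c2: "4 \<le> card (verts H - X)"
    using card_mono[of "verts H - X" "\<eta>v ` (verts G - verts C)"] card(2) by linarith
  have "5 \<le> card (edge_cut H X)" by (rule five_connected_cut[OF H XH c1 c2])
  moreover have "card (edge_cut H X) \<le> 4" by (rule cut_closed_le_4[OF \<eta> sH card(1) closed])
  ultimately show False by simp
qed

end

lemma path_edges_successively:
  "successively (\<lambda>v w. {v, w} \<in> E) p \<Longrightarrow> path_edges p \<subseteq> E"
  by (induction p rule: induct_list012) auto

lemma consecutive_hd:
  assumes "distinct p" "p \<noteq> []" "{hd p, z} \<in> path_edges p"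
  shows "consecutive p (hd p) z"
proof -
  obtain a b r where p: "p = a # b # r" using assms(2,3) by (cases p; cases "tl p") auto
  have "{a, z} \<notin> path_edges (b # r)" using path_edges_subset[of "{a, z}" "b # r"] assms(1) p by auto
  then have "z = b" using assms(3) p by (auto simp: doubleton_eq_iff)
  then show ?thesis using p by (auto simp: consecutive_def intro!: exI[of _ 0])
qed

context quadrangle
begin

text \<open>An edge of the image of \<open>G\<close> that leaves the core does so at a branch vertex
  of \<open>C\<close>, as the first edge of the outer path there. It is then a forward arc and not
  residual.\<close>

lemma edge_at_core:
  assumes \<eta>: "homeo_embedding \<eta>v \<eta>e G H" and r: "residual \<eta>v \<eta>e H v w" "v \<in> core \<eta>e" "w \<notin> core \<eta>e"
    and g: "g \<in> edges G"
  shows "{v, w} \<notin> edges (\<eta>e g)"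
proof
  assume vw: "{v, w} \<in> edges (\<eta>e g)"
  have "simple_graph (\<eta>e g)" using homeo_embedding_subgraph[OF \<eta> simple g] by (simp add: subgraph_def)
  then have m: "v \<in> verts (\<eta>e g)" "w \<in> verts (\<eta>e g)" using edge_subset[OF _ vw] by auto
  have gC: "g \<notin> edges C" using m(2) r(3) by (auto simp: core_def)
  obtain e where e: "e \<in> edges C" "v \<in> verts (\<eta>e e)" using r(2) by (auto simp: core_def)
  have "e \<in> edges G" using e CG by auto
  then have "v \<in> \<eta>v ` (e \<inter> g)" using homeo_embedding_disjoint[OF \<eta> simple _ g, of e] e gC m by auto
  then obtain c where c: "c \<in> e" "c \<in> g" "v = \<eta>v c" by auto
  have cC: "c \<in> verts C" using C_edge[OF e(1)] c by auto
  obtain a b d where n: "d \<notin> verts C" "{c, a} \<in> edges C" "{c, b} \<in> edges C" "g \<in> {{c, a}, {c, b}, {c, d}}"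
    using nbrs[OF cC] g c(2) by metis
  then have gd: "g = {c, d}" using gC by auto
  obtain p where p: "p \<noteq> []" "distinct p" "hd p = \<eta>v c" "\<eta>e g = path_graph p"
    using homeo_embedding_path[OF \<eta>, of c d] g gd by (metis is_pathE)
  have "consecutive p (hd p) w" using p vw c by (intro consecutive_hd) auto
  then have "forward \<eta>v \<eta>e G C v w" unfolding forward_def using cC n(1) g gd p c by metis
  then show False using r(1) by (simp add: residual_def)
qed

text \<open>The initial part of a shortest walk, up to its first return to the image of \<open>G\<close>, is an
  \<open>\<eta>\<close>-path. If it does not yield a leap, it ends in some \<open>\<eta>({c, d})\<close>; rerouting along it moves
  its end into the core, and the rest of the walk is residual for the new embedding.\<close>

lemma walk_shortens:
  assumes \<eta>: "homeo_embedding \<eta>v \<eta>e G H" and G: "cubic G" and H: "cubic H"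
    and ws: "walk \<eta>v \<eta>e H ws"
    and min: "\<And>us. walk \<eta>v \<eta>e H us \<Longrightarrow> length ws \<le> length us"
    and no: "\<And>e f s t Q. e \<in> edges C \<Longrightarrow> f \<in> edges G \<Longrightarrow> f \<inter> verts C = {} \<Longrightarrow>
      s \<in> verts (\<eta>e e) \<Longrightarrow> s \<notin> \<eta>v ` verts G \<Longrightarrow> t \<in> verts (\<eta>e f) \<Longrightarrow> t \<notin> \<eta>v ` verts G \<Longrightarrow>
      distinct Q \<Longrightarrow> Q \<noteq> [] \<Longrightarrow> hd Q = s \<Longrightarrow> last Q = t \<Longrightarrow> set Q \<subseteq> verts H \<Longrightarrow> path_edges Q \<subseteq> edges H \<Longrightarrow>
      set Q \<inter> embedded_verts \<eta>v \<eta>e G \<subseteq> {s, t} \<Longrightarrow> False"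
  shows "\<exists>\<eta>v' \<eta>e' us. homeo_embedding \<eta>v' \<eta>e' G H \<and>
    (\<forall>w \<in> verts G - verts C. \<eta>v' w = \<eta>v w) \<and> (\<forall>g \<in> edges G. g \<inter> verts C = {} \<longrightarrow> \<eta>e' g = \<eta>e g) \<and>
    walk \<eta>v' \<eta>e' H us \<and> length us < length ws"
proof -
  have sH: "simple_graph H" using H by (simp add: cubic_def)
  let ?R = "residual \<eta>v \<eta>e H" and ?V = "embedded_verts \<eta>v \<eta>e G"
  have core_V: "core \<eta>e \<subseteq> ?V" using CG by (auto simp: core_def embedded_verts_def)
  have rim_V: "rim \<eta>v \<eta>e \<subseteq> ?V" by (auto simp: rim_def embedded_verts_def)
  note wsD = ws[unfolded walk_def]
  \<comment> \<open>Cutting out the part between two visits to the same vertex leaves a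
    walk.\<close>
  have dist: "distinct ws"
  proof (rule ccontr)
    assume "\<not> ?thesis"
    then obtain xs y ys zs where s: "ws = xs @ [y] @ ys @ [y] @ zs" using not_distinct_decomp by blast
    have "walk \<eta>v \<eta>e H (xs @ [y] @ zs)"
      using wsD unfolding walk_def s by (auto simp: successively_append_iff successively_Cons hd_append)
    then show False using min[of "xs @ [y] @ zs"] s by simp
  qed
  obtain v0 r where v0: "ws = v0 # r" using wsD by (cases ws) auto
  have v0c: "v0 \<in> core \<eta>e" using wsD v0 by simp
  \<comment> \<open>From a later visit to the core, the rest of the list would be a shorter
    walk.\<close>
  have no_core: "z \<notin> core \<eta>e" if zr: "z \<in> set r" for z
  proof
    assume z: "z \<in> core \<eta>e"
    obtain xs ys where s: "r = xs @ z # ys" using split_list[OF zr] by blast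
    have "walk \<eta>v \<eta>e H (z # ys)"
      using wsD z unfolding walk_def v0 s by (auto simp: successively_append_iff successively_Cons split: if_splits)
    then show False using min[of "z # ys"] v0 s by simp
  qed
  have "v0 \<notin> rim \<eta>v \<eta>e" using core_rim_disjoint[OF \<eta>] v0c by auto
  then have "r \<noteq> []" "last r \<in> rim \<eta>v \<eta>e" using wsD v0 by (auto split: if_splits)
  then have "\<exists>z \<in> set r. z \<in> ?V" using rim_V by (meson last_in_set subsetD)
  \<comment> \<open>\<open>z\<close> is the first return to the image of \<open>G\<close>, so the
    interior of the initial part avoids that image.\<close>
  then obtain ys z zs where yz: "r = ys @ z # zs" "z \<in> ?V" "\<forall>y \<in> set ys. y \<notin> ?V"
    using split_list_first_prop[of r "\<lambda>z. z \<in> ?V"] by blast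
  let ?Q = "v0 # ys @ [z]"
  have ws_Q: "ws = ?Q @ zs" using v0 yz by simp
  have zc: "z \<notin> core \<eta>e" using no_core yz by simp
  have ws_z: "ws = (v0 # ys) @ z # zs" using v0 yz by simp
  have succQ: "successively ?R ?Q" using wsD successively_append_iff[of ?R ?Q zs] unfolding ws_Q by blast
  have succz: "successively ?R (z # zs)"
    using wsD successively_append_iff[of ?R "v0 # ys" "z # zs"] unfolding ws_z by blast
  have Qe: "path_edges ?Q \<subseteq> edges H"
    by (rule path_edges_successively, rule successively_mono[OF succQ]) (simp add: residual_def)
  have Qv: "set ?Q \<subseteq> verts H"
  proof
    fix x assume "x \<in> set ?Q"
    then obtain h where "h \<in> path_edges ?Q" "x \<in> h" using path_vertex_in_edge[of ?Q x] by auto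
    then show "x \<in> verts H" using Qe edge_subset[OF sH] by auto
  qed
  have QV: "set ?Q \<inter> ?V \<subseteq> {v0, z}" using yz by auto
  have Qd: "distinct ?Q" using dist ws_Q by simp
  define w1 where "w1 = hd (ys @ [z])"
  have w1: "?R v0 w1" "w1 \<notin> core \<eta>e" "{v0, w1} \<in> edges H"
    using succQ no_core[of w1] yz unfolding w1_def by (cases ys; auto simp: residual_def)+
  \<comment> \<open>All edges at a branch vertex belong to the image of \<open>G\<close>, whereas
    the first edge of the walk does not.\<close>
  have v0b: "v0 \<notin> \<eta>v ` verts G"
  proof
    assume "v0 \<in> \<eta>v ` verts G"
    then obtain u where u: "u \<in> verts G" "v0 = \<eta>v u" by auto
    then obtain g where "g \<in> edges G" "{v0, w1} \<in> edges (\<eta>e g)"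
      using branch_edge[OF \<eta> G H u(1) w1(3)] by auto
    then show False using edge_at_core[OF \<eta> w1(1) v0c w1(2)] by blast
  qed
  \<comment> \<open>Otherwise the last edge of \<open>?Q\<close> belongs to the image of
    \<open>G\<close>, and so does its other end \<open>y\<close>. As \<open>z\<close> is the first
    return, \<open>y\<close> must be \<open>v0\<close>, and then the edge leaves the core inside the
    image of \<open>G\<close>, which is impossible.\<close>
  have zb: "z \<notin> \<eta>v ` verts G"
  proof
    assume "z \<in> \<eta>v ` verts G"
    then obtain u where u: "u \<in> verts G" "z = \<eta>v u" by auto
    define y where "y = last (v0 # ys)"
    have "successively ?R ((v0 # ys) @ [z])" using succQ by simp
    then have yR: "?R y z" unfolding y_def successively_append_iff by simp
    then have "{y, z} \<in> edges H" by (simp add: residual_def)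
    then obtain g where g: "g \<in> edges G" "{y, z} \<in> edges (\<eta>e g)"
      using branch_edge[OF \<eta> G H u(1)] u(2) by blast
    have "simple_graph (\<eta>e g)" using homeo_embedding_subgraph[OF \<eta> simple g(1)] by (simp add: subgraph_def)
    then have "y \<in> ?V" using edge_subset[OF _ g(2)] g(1) by (auto simp: embedded_verts_def)
    then have "ys = []" using yz(3) unfolding y_def by (metis last_ConsR last_in_set)
    then have "y = v0" by (simp add: y_def)
    then show False using edge_at_core[OF \<eta> _ v0c zc g(1)] yR g(2) by blast
  qed
  obtain e where e: "e \<in> edges C" "v0 \<in> verts (\<eta>e e)" using v0c by (auto simp: core_def)
  obtain g where g: "g \<in> edges G" "z \<in> verts (\<eta>e g)" using yz(2) zb by (auto simp: embedded_verts_def)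
  have gC: "g \<notin> edges C" using zc g by (auto simp: core_def)
  have "g \<inter> verts C \<noteq> {}"
  proof
    assume "g \<inter> verts C = {}"
    then show False using no[OF e(1) g(1) _ e(2) v0b g(2) zb Qd _ _ _ Qv Qe QV] by simp
  qed
  then obtain c where c: "c \<in> verts C" "c \<in> g" by auto
  obtain a b d where n: "d \<notin> verts C" "{c, a} \<in> edges C" "{c, b} \<in> edges C" "g \<in> {{c, a}, {c, b}, {c, d}}"
    using nbrs[OF c(1)] g(1) c(2) by metis
  \<comment> \<open>\<open>z\<close> is outside the core, so \<open>g\<close> is not an edge of
    \<open>C\<close> and can only be the outer edge at \<open>c\<close>.\<close>
  then have gd: "g = {c, d}" using gC by auto
  have "\<exists>\<eta>v' \<eta>e'. homeo_embedding \<eta>v' \<eta>e' G H \<and>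
    (\<forall>w \<in> verts G - verts C. \<eta>v' w = \<eta>v w) \<and> (\<forall>g \<in> edges G. g \<inter> verts C = {} \<longrightarrow> \<eta>e' g = \<eta>e g) \<and>
    z \<in> core \<eta>e' \<and> (\<forall>x y. forward \<eta>v' \<eta>e' G C x y \<longrightarrow> forward \<eta>v \<eta>e G C x y \<or> x \<in> core \<eta>e)"
    by (rule reroute[OF \<eta> sH e v0b c(1) n(1) g[unfolded gd] zb Qd _ _ _ Qv Qe QV]) auto
  then obtain \<eta>v' \<eta>e' where \<eta>': "homeo_embedding \<eta>v' \<eta>e' G H" "\<forall>w \<in> verts G - verts C. \<eta>v' w = \<eta>v w"
    "\<forall>g \<in> edges G. g \<inter> verts C = {} \<longrightarrow> \<eta>e' g = \<eta>e g" "z \<in> core \<eta>e'"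
    "\<And>x y. forward \<eta>v' \<eta>e' G C x y \<Longrightarrow> forward \<eta>v \<eta>e G C x y \<or> x \<in> core \<eta>e" by blast
  \<comment> \<open>The rim depends only on values off \<open>C\<close>, so the target of the walk
    has not moved.\<close>
  have "rim \<eta>v' \<eta>e' = rim \<eta>v \<eta>e" using \<eta>'(2,3) unfolding rim_def by (auto simp: image_iff)
  moreover have "last (z # zs) = last ws" unfolding ws_Q by simp
  \<comment> \<open>An arc can stop being residual only if it starts in the old core, and the
    vertices from \<open>z\<close> onwards avoid it.\<close>
  moreover have "successively (residual \<eta>v' \<eta>e' H) (z # zs)"
    using succz
  proof (rule successively_mono)
    fix x y assume "x \<in> set (z # zs)" and xy: "?R x y"
    then have "x \<notin> core \<eta>e" using no_core yz(1) by auto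
    then show "residual \<eta>v' \<eta>e' H x y" using xy \<eta>'(5) by (auto simp: residual_def)
  qed
  ultimately have "walk \<eta>v' \<eta>e' H (z # zs)" using \<eta>'(4) wsD by (simp add: walk_def)
  moreover have "length (z # zs) < length ws" unfolding ws_Q by simp
  ultimately show ?thesis using \<eta>' by blast
qed

end

section \<open>Descent on the length of the residual walk\<close>

theorem theorem9p2:
  fixes G F C H :: "'a::infinite ugraph" and L :: "'a ugraph set"
  assumes "cubic G" and "cyclically_connected 4 G" and "card (verts G) \<ge> 8"
    and "subgraph F G" and "\<forall>v \<in> verts F. degree F v \<ge> 2"
    and "circuit_of C G" and "circuit_length C = 4" and "verts C \<inter> verts F = {}"
    and "\<forall>K \<in> L. cubic K \<and> subgraph F K"
    and "\<forall>G'. is_leap F C G G' \<longrightarrow> (\<exists>K \<in> L. F_contains F G' K)"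
    and "cubic H" and "cyclically_connected 5 H" and "subgraph F H"
    and "\<forall>K \<in> L. \<not> F_contains F H K"
  shows "\<not> F_contains F H G"
proof
  assume "F_contains F H G"
  then obtain \<eta>v \<eta>e where \<eta>: "homeo_embedding \<eta>v \<eta>e G H" "fixes_subgraph \<eta>v \<eta>e F"
    by (auto simp: F_contains_def)
  have sG: "simple_graph G" and sH: "simple_graph H" using assms by (auto simp: cubic_def)
  \<comment> \<open>Girth four excludes chords of \<open>C\<close>, so every vertex of
    \<open>C\<close> has exactly one edge to the outside.\<close>
  have "4 \<le> girth G" using assms(2) by (simp add: cyclically_connected_def numeral_eq_enat)
  note quad = circuit_four_quadrangle[OF assms(1) this assms(6,7)]
  interpret quadrangle G C by (rule quad(1))
  have FC: "e \<inter> verts C = {}" if "e \<in> edges F" for e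
    using assms(4,8) edge_subset[OF _ that] by (auto simp: subgraph_def)
  have FG: "e \<in> edges G" if "e \<in> edges F" for e using assms(4) that by (auto simp: subgraph_def)
  define E where "E \<alpha>v \<alpha>e \<longleftrightarrow> homeo_embedding \<alpha>v \<alpha>e G H \<and>
    (\<forall>w \<in> verts G - verts C. \<alpha>v w = \<eta>v w) \<and> (\<forall>g \<in> edges G. g \<inter> verts C = {} \<longrightarrow> \<alpha>e g = \<eta>e g)" for \<alpha>v \<alpha>e
  have fixed: "fixes_subgraph \<alpha>v \<alpha>e F" if "E \<alpha>v \<alpha>e" for \<alpha>v \<alpha>e
  proof -
    have "verts F \<subseteq> verts G - verts C" using assms(4,8) by (auto simp: subgraph_def)
    then show ?thesis using that \<eta>(2) FC FG by (auto simp: E_def fixes_subgraph_def)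
  qed
  have no: False
    if E: "E \<alpha>v \<alpha>e" and ef: "e \<in> edges C" "f \<in> edges G" "f \<inter> verts C = {}"
      and st: "s \<in> verts (\<alpha>e e)" "s \<notin> \<alpha>v ` verts G" "t \<in> verts (\<alpha>e f)" "t \<notin> \<alpha>v ` verts G"
      and Q: "distinct Q" "Q \<noteq> []" "hd Q = s" "last Q = t" "set Q \<subseteq> verts H" "path_edges Q \<subseteq> edges H"
        "set Q \<inter> embedded_verts \<alpha>v \<alpha>e G \<subseteq> {s, t}"
    for \<alpha>v \<alpha>e e f s t Q
  proof -
    have \<alpha>: "homeo_embedding \<alpha>v \<alpha>e G H" using E by (simp add: E_def)
    have eG: "e \<in> edges G" using ef CG by auto
    have "e \<noteq> {}" using edge_card[OF sG eG] by auto
    then have eF: "e \<notin> edges F" "e \<noteq> f" using FC[of e] C_edge[OF ef(1)] ef(3) by blast+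
    \<comment> \<open>For \<open>f\<close> in \<open>F\<close> the image is the edge
      \<open>f\<close> itself with both ends fixed, so \<open>t\<close> would be a branch
      vertex.\<close>
    have fF: "f \<notin> edges F"
    proof
      assume f: "f \<in> edges F"
      then have "t \<in> f" using st(3) fixed[OF E] by (simp add: fixes_subgraph_def)
      moreover have "f \<subseteq> verts F" using f assms(4) edge_subset by (auto simp: subgraph_def)
      ultimately have "t \<in> verts F" "t \<in> verts G" using assms(4) by (auto simp: subgraph_def)
      then show False using st(4) fixed[OF E] by (metis fixes_subgraph_def imageI)
    qed
    obtain x y where xy: "x \<notin> verts G" "y \<notin> verts G" "x \<noteq> y" "simple_graph (plus_edge G e f x y)"
      "F_contains F H (plus_edge G e f x y)"
      using F_contains_plus_edge[OF \<alpha> fixed[OF E] sG sH assms(4) eG eF(1) st(1,2) ef(2) fF st(3,4) eF(2) Q] by blast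
    have "is_leap F C G (plus_edge G e f x y)" unfolding is_leap_def using ef fF xy by blast
    then obtain K where K: "K \<in> L" "F_contains F (plus_edge G e f x y) K" using assms(10) by blast
    then have "F_contains F H K" using F_contains_trans[OF xy(5) K(2) _ xy(4) sH] assms(9) by (auto simp: cubic_def)
    then show False using assms(14) K(1) by blast
  qed
  \<comment> \<open>The length is minimized over embeddings and walks together, because a rerouting
    replaces both.\<close>
  define W where "W n \<longleftrightarrow> (\<exists>\<alpha>v \<alpha>e ws. E \<alpha>v \<alpha>e \<and> walk \<alpha>v \<alpha>e H ws \<and> length ws = n)" for n
  have "E \<eta>v \<eta>e" using \<eta> by (simp add: E_def)
  then have "\<exists>n. W n"
    using residual_walk_exists[OF \<eta>(1) assms(11,12) quad(2) assms(3)] unfolding W_def by blast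
  then have "W (LEAST n. W n)" by (rule LeastI_ex)
  then obtain \<alpha>v \<alpha>e ws where \<alpha>: "E \<alpha>v \<alpha>e" "walk \<alpha>v \<alpha>e H ws" "length ws = (LEAST n. W n)"
    unfolding W_def by blast
  have min: "length ws \<le> length us" if "E \<beta>v \<beta>e" "walk \<beta>v \<beta>e H us" for \<beta>v \<beta>e us
    unfolding \<alpha>(3) using that by (intro Least_le) (auto simp: W_def)
  have h: "homeo_embedding \<alpha>v \<alpha>e G H" using \<alpha>(1) by (simp add: E_def)
  have "\<exists>\<beta>v \<beta>e us. homeo_embedding \<beta>v \<beta>e G H \<and>
    (\<forall>w \<in> verts G - verts C. \<beta>v w = \<alpha>v w) \<and> (\<forall>g \<in> edges G. g \<inter> verts C = {} \<longrightarrow> \<beta>e g = \<alpha>e g) \<and>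
    walk \<beta>v \<beta>e H us \<and> length us < length ws"
    by (rule walk_shortens[OF h assms(1,11) \<alpha>(2) min[OF \<alpha>(1)]], assumption, rule no[OF \<alpha>(1)])
  then obtain \<beta>v \<beta>e us where \<beta>: "homeo_embedding \<beta>v \<beta>e G H" "\<forall>w \<in> verts G - verts C. \<beta>v w = \<alpha>v w"
    "\<forall>g \<in> edges G. g \<inter> verts C = {} \<longrightarrow> \<beta>e g = \<alpha>e g" "walk \<beta>v \<beta>e H us" "length us < length ws"
    by blast
  have "E \<beta>v \<beta>e" using \<beta> \<alpha>(1) unfolding E_def by auto
  then show False using min \<beta> by fastforce
qed

end
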